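(* Let $\mathcal{A}$ be a well-behaved assemblage and let $m$ be the local complexity measure induced by $\mathcal{A}$. Then for any boolean function $f$ we have $m^{\lim}(f)=\hat{m}(f)$.
   Context: Boolean functions are maps $f:\{0,1\}^I\to\{0,1\}$ on a finite index set $I$; a weight function over $I$ is a map $I\to\mathbb{R}_{\ge 0}$, and $|w|=\sum_{i\in I}w(i)$. An assemblage $\mathcal{A}$ assigns to every boolean function $f$ on an index set $I$ and every $x\in\{0,1\}^I$ a compact (as a subset of $\mathbb{R}^I$) family $\mathcal{A}_x(f)$ of weight functions over $I$. The induced local measure is $m_x(f)=\min\{|w|: w\in\mathcal{A}_x(f)\}$; further $m_b(f)=\max\{m_x(f): f(x)=b\}$ for $b\in\{0,1\}$ and $m(f)=\max\{m_0(f),m_1(f)\}$. Compositions: if $f$ is on $I$ and $g$ on $J$, then $f\circ g$ is the function on $I\times J$ given by $(f\circ g)(z)=f\big((g(z_{i,\cdot}))_{i\in I}\big)$ where $z_{i,\cdot}\in\{0,1\}^J$ is the block of $z$ indexed by $\{i\}\times J$. Let $f^{(1)}=f$, $f^{(k)}=f\circ f^{(k-1)}$, and $m^{\lim}(f)=\liminf_{k\to\infty} m(f^{(k)})^{1/k}$. Well-behaved: Let $T$ be a finite rooted tree all of whose leaves are at the same depth, with leaf set $L(T)$ and, for an internal node $v$, children set $C(v)$. A $T$-ensemble of boolean functions is $(f_v)_{v \text{ internal}}$ with $f_v:\{0,1\}^{C(v)}\to\{0,1\}$; its composition $F$ is the function on $\{0,1\}^{L(T)}$ computed as a circuit: for input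 $\alpha$, set $b(\ell)=\alpha(\ell)$ for leaves and $b(v)=f_v(b_v)$ for internal $v$, where $b_v=(b(u))_{u\in C(v)}$; then $F(\alpha)=b(\text{root})$. A $T$-ensemble of weight functions $(w_v)$, $w_v:C(v)\to\mathbb{R}_{\ge0}$, composes to the weight function $w$ on $L(T)$ with $w(\ell)=\prod w_v(u)$ over the edges $(v,u)$ on the path from the root to $\ell$. Such an ensemble is compatible with $(f_v)$ and $\alpha$ if $w_v\in\mathcal{A}_{b_v}(f_v)$ for every internal $v$. The assemblage $\mathcal{A}$ is well-behaved if for every such $T$, every $T$-ensemble $(f_v)$ with composition $F$ and every input $\alpha$: (1) the composition of every weight-function ensemble compatible with $(f_v)$ and $\alpha$ belongs to $\mathcal{A}_\alpha(F)$; (2) for every $w\in\mathcal{A}_\alpha(F)$ there is a weight-function ensemble compatible with $(f_v)$ and $\alpha$ whose composition has total weight at most $|w|$. Characteristic value: an assignment selector for $f$ is a pair $\vec\alpha=(\alpha^0,\alpha^1)$ of assignments in $\{0,1\}^I$; it is $f$-compatible if $f(\alpha^0)=0$ and $f(\alpha^1)=1$. For a pair $\vec w=(w^0,w^1)$ of weight functions over $I$, the profile matrix $M_{\vec\alpha,\vec w}$ is the $2\times 2$ matrix with rows and columns indexed by $\{0,1\}$ whose $(s,t)$ entry is $\sum_{j:\alpha^s_j=t}w^s(j)$. For $f$-compatible $\vec\alpha$, $\hat m_{\vec\alpha}(f)$ is the minimum of $\rho(M_{\vec\alpha,\vec w})$ over all $\vec w$ with $w^0\in\mathcal{A}_{\alpha^0}(f)$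 and $w^1\in\mathcal{A}_{\alpha^1}(f)$, where $\rho$ denotes the spectral radius (largest absolute value of an eigenvalue); $\hat m(f)$ is the maximum of $\hat m_{\vec\alpha}(f)$ over all $f$-compatible $\vec\alpha$.
   Formalization: The boolean function f is assumed nonconstant, since for constant f there is no f-compatible selector and the maximum defining the characteristic value is over the empty set; the families of weight functions are taken nonempty so that the minima exist. *)

theory Defs
  imports
    "HOL-Analysis.Function_Topology"
    "HOL-Library.Extended_Real"
    "HOL-Library.Liminf_Limsup"
    "Jordan_Normal_Form.Spectral_Radius"
begin

text \<open>
  Bits are booleans. Functions on an index set (assignments, weight functions, boolean functions
  on the cube) are represented extensionally, i.e. with value \<^const>\<open>undefined\<close> outside
  their domain, so that equality of representatives is equality of functions.
\<close>

definition cube :: "'i set \<Rightarrow> ('i \<Rightarrow> bool) set" where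
  "cube I = I \<rightarrow>\<^sub>E UNIV"

record 'i bfun =
  index :: "'i set"
  eval :: "('i \<Rightarrow> bool) \<Rightarrow> bool"

definition is_bfun :: "'i bfun \<Rightarrow> bool" where
  "is_bfun f \<longleftrightarrow> finite (index f) \<and> eval f \<in> extensional (cube (index f))"

definition nonconstant :: "'i bfun \<Rightarrow> bool" where
  "nonconstant f \<longleftrightarrow>
     (\<exists>x \<in> cube (index f). \<exists>y \<in> cube (index f). eval f x \<noteq> eval f y)"

definition weights :: "'i set \<Rightarrow> ('i \<Rightarrow> real) set" where
  "weights I = I \<rightarrow>\<^sub>E {0..}"

definition total :: "'i set \<Rightarrow> ('i \<Rightarrow> real) \<Rightarrow> real" where
  "total I w = (\<Sum>i\<in>I. w i)"

type_synonym 'i family = "'i bfun \<Rightarrow> ('i \<Rightarrow> bool) \<Rightarrow> ('i \<Rightarrow> real) set"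

text \<open>
  Here \<^typ>\<open>'i\<close> is the universe from which index sets are drawn. The families are
  nonempty because the minimum of the total weight over each of them has to exist.
\<close>

definition assemblage :: "'i family \<Rightarrow> bool" where
  "assemblage A \<longleftrightarrow>
     (\<forall>f x. is_bfun f \<longrightarrow> x \<in> cube (index f) \<longrightarrow>
        A f x \<noteq> {} \<and> A f x \<subseteq> weights (index f) \<and>
        compactin (powertop_real (index f)) (A f x))"

text \<open>The infimum is a minimum: the total weight is continuous and \<open>A f x\<close> is compact.\<close>

definition local_measure :: "'i family \<Rightarrow> 'i bfun \<Rightarrow> ('i \<Rightarrow> bool) \<Rightarrow> real" where
  "local_measure A f x = Inf (total (index f) ` A f x)"

definition bit_measure :: "'i family \<Rightarrow> bool \<Rightarrow> 'i bfun \<Rightarrow> real" where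
  "bit_measure A b f = Max (local_measure A f ` {x \<in> cube (index f). eval f x = b})"

definition measure_of_family :: "'i family \<Rightarrow> 'i bfun \<Rightarrow> real" where
  "measure_of_family A f = max (bit_measure A False f) (bit_measure A True f)"


text \<open>
  A universe of indices closed under pairing, so that \<open>I \<times> J\<close> is again a set of indices
  of the same type.
\<close>

datatype 'a label = Atom 'a | Pr "'a label" "'a label"

definition label_times :: "'a label set \<Rightarrow> 'a label set \<Rightarrow> 'a label set" where
  "label_times I J = {Pr i j | i j. i \<in> I \<and> j \<in> J}"

definition bfun_comp :: "'a label bfun \<Rightarrow> 'a label bfun \<Rightarrow> 'a label bfun" where
  "bfun_comp f g =
     \<lparr> index = label_times (index f) (index g),
       eval = (\<lambda>z \<in> cube (label_times (index f) (index g)).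
                 eval f (\<lambda>i \<in> index f. eval g (\<lambda>j \<in> index g. z (Pr i j)))) \<rparr>"

text \<open>The power is meant for exponents \<open>k \<ge> 1\<close>; the value at \<open>0\<close> is a dummy.\<close>

fun bfun_pow :: "'a label bfun \<Rightarrow> nat \<Rightarrow> 'a label bfun" where
  "bfun_pow f 0 = f"
| "bfun_pow f (Suc 0) = f"
| "bfun_pow f (Suc (Suc k)) = bfun_comp f (bfun_pow f (Suc k))"

definition measure_lim :: "'a label family \<Rightarrow> 'a label bfun \<Rightarrow> ereal" where
  "measure_lim A f = liminf (\<lambda>k. ereal (root k (measure_of_family A (bfun_pow f k))))"


text \<open>Edges point from parent to child.\<close>

record 'i rtree =
  nodes :: "'i set"
  top_node :: 'i
  edges :: "('i \<times> 'i) set"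

definition rooted_tree :: "'i rtree \<Rightarrow> bool" where
  "rooted_tree T \<longleftrightarrow>
     finite (nodes T) \<and> top_node T \<in> nodes T \<and> edges T \<subseteq> nodes T \<times> nodes T \<and>
     (\<forall>v. (v, top_node T) \<notin> edges T) \<and>
     (\<forall>u \<in> nodes T - {top_node T}. \<exists>!v. (v, u) \<in> edges T) \<and>
     (\<forall>u \<in> nodes T. (top_node T, u) \<in> (edges T)\<^sup>*)"

definition children :: "'i rtree \<Rightarrow> 'i \<Rightarrow> 'i set" where
  "children T v = {u. (v, u) \<in> edges T}"

definition leaves :: "'i rtree \<Rightarrow> 'i set" where
  "leaves T = {v \<in> nodes T. children T v = {}}"

definition internal :: "'i rtree \<Rightarrow> 'i set" where
  "internal T = nodes T - leaves T"

definition equal_depth :: "'i rtree \<Rightarrow> bool" where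
  "equal_depth T \<longleftrightarrow> (\<exists>d. \<forall>l \<in> leaves T. (top_node T, l) \<in> edges T ^^ d)"

definition bfun_ensemble :: "'i rtree \<Rightarrow> ('i \<Rightarrow> 'i bfun) \<Rightarrow> bool" where
  "bfun_ensemble T fs \<longleftrightarrow>
     (\<forall>v \<in> internal T. is_bfun (fs v) \<and> index (fs v) = children T v)"

definition is_node_values ::
    "'i rtree \<Rightarrow> ('i \<Rightarrow> 'i bfun) \<Rightarrow> ('i \<Rightarrow> bool) \<Rightarrow> ('i \<Rightarrow> bool) \<Rightarrow> bool" where
  "is_node_values T fs \<alpha> b \<longleftrightarrow>
     b \<in> extensional (nodes T) \<and>
     (\<forall>l \<in> leaves T. b l = \<alpha> l) \<and>
     (\<forall>v \<in> internal T. b v = eval (fs v) (restrict b (children T v)))"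

definition node_values :: "'i rtree \<Rightarrow> ('i \<Rightarrow> 'i bfun) \<Rightarrow> ('i \<Rightarrow> bool) \<Rightarrow> 'i \<Rightarrow> bool" where
  "node_values T fs \<alpha> = (THE b. is_node_values T fs \<alpha> b)"

definition tree_bfun :: "'i rtree \<Rightarrow> ('i \<Rightarrow> 'i bfun) \<Rightarrow> 'i bfun" where
  "tree_bfun T fs =
     \<lparr> index = leaves T,
       eval = (\<lambda>\<alpha> \<in> cube (leaves T). node_values T fs \<alpha> (top_node T)) \<rparr>"

text \<open>In a rooted tree these are exactly the edges of the path from the root to \<open>l\<close>.\<close>

definition path_edges :: "'i rtree \<Rightarrow> 'i \<Rightarrow> ('i \<times> 'i) set" where
  "path_edges T l = {(v, u) \<in> edges T. (u, l) \<in> (edges T)\<^sup>*}"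

definition tree_weight :: "'i rtree \<Rightarrow> ('i \<Rightarrow> 'i \<Rightarrow> real) \<Rightarrow> 'i \<Rightarrow> real" where
  "tree_weight T ws = (\<lambda>l \<in> leaves T. \<Prod>(v, u) \<in> path_edges T l. ws v u)"

definition compatible_weights ::
    "'i family \<Rightarrow> 'i rtree \<Rightarrow> ('i \<Rightarrow> 'i bfun) \<Rightarrow> ('i \<Rightarrow> bool) \<Rightarrow> ('i \<Rightarrow> 'i \<Rightarrow> real) \<Rightarrow> bool" where
  "compatible_weights A T fs \<alpha> ws \<longleftrightarrow>
     (\<forall>v \<in> internal T. ws v \<in> weights (children T v) \<and>
        ws v \<in> A (fs v) (restrict (node_values T fs \<alpha>) (children T v)))"

definition well_behaved :: "'i family \<Rightarrow> bool" where
  "well_behaved A \<longleftrightarrow>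
     (\<forall>T fs \<alpha>. rooted_tree T \<longrightarrow> equal_depth T \<longrightarrow> bfun_ensemble T fs \<longrightarrow> \<alpha> \<in> cube (leaves T) \<longrightarrow>
        (\<forall>ws. compatible_weights A T fs \<alpha> ws \<longrightarrow> tree_weight T ws \<in> A (tree_bfun T fs) \<alpha>) \<and>
        (\<forall>w \<in> A (tree_bfun T fs) \<alpha>. \<exists>ws. compatible_weights A T fs \<alpha> ws \<and>
            total (leaves T) (tree_weight T ws) \<le> total (leaves T) w))"


text \<open>
  Pairs indexed by bits are functions on \<^typ>\<open>bool\<close>. Rows and columns of the profile matrix
  are numbered 0 and 1, with number \<open>s\<close> standing for the bit \<open>s = 1\<close>.
\<close>

definition compatible_selector :: "'i bfun \<Rightarrow> (bool \<Rightarrow> 'i \<Rightarrow> bool) \<Rightarrow> bool" where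
  "compatible_selector f \<alpha> \<longleftrightarrow> (\<forall>b. \<alpha> b \<in> cube (index f) \<and> eval f (\<alpha> b) = b)"

definition profile_matrix ::
    "'i set \<Rightarrow> (bool \<Rightarrow> 'i \<Rightarrow> bool) \<Rightarrow> (bool \<Rightarrow> 'i \<Rightarrow> real) \<Rightarrow> complex mat" where
  "profile_matrix I \<alpha> w =
     mat 2 2 (\<lambda>(s, t). complex_of_real (\<Sum>j \<in> {j \<in> I. \<alpha> (s = 1) j = (t = 1)}. w (s = 1) j))"

text \<open>
  Again the infimum is a minimum, since the spectral radius is continuous and both families are
  compact.
\<close>

definition selector_value :: "'i family \<Rightarrow> 'i bfun \<Rightarrow> (bool \<Rightarrow> 'i \<Rightarrow> bool) \<Rightarrow> real" where
  "selector_value A f \<alpha> =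
     Inf {spectral_radius (profile_matrix (index f) \<alpha> w) | w. \<forall>b. w b \<in> A f (\<alpha> b)}"

definition characteristic_value :: "'i family \<Rightarrow> 'i bfun \<Rightarrow> real" where
  "characteristic_value A f = Max (selector_value A f ` {\<alpha>. compatible_selector f \<alpha>})"


lemma rooted_tree_acyclic:
  assumes "rooted_tree T"
  shows "acyclic (edges T)"
proof -
  have sub: "edges T \<subseteq> nodes T \<times> nodes T" and top: "\<And>v. (v, top_node T) \<notin> edges T"
    and reach: "\<And>u. u \<in> nodes T \<Longrightarrow> (top_node T, u) \<in> (edges T)\<^sup>*"
    and uniq: "\<And>u v v'. (v, u) \<in> edges T \<Longrightarrow> (v', u) \<in> edges T \<Longrightarrow> v = v'"
    using assms unfolding rooted_tree_def by (auto, metis DiffI SigmaD2 singletonD subsetD)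
  have no: "(x, x) \<notin> (edges T)\<^sup>+" if "(top_node T, x) \<in> (edges T)\<^sup>*" for x
    using that
  proof (induction rule: rtrancl_induct)
    case base
    then show ?case using top by (meson tranclE)
  next
    case (step y z)
    show ?case
    proof
      assume "(z, z) \<in> (edges T)\<^sup>+"
      then obtain p where "(z, p) \<in> (edges T)\<^sup>*" "(p, z) \<in> edges T" by (meson tranclD2)
      then have "(z, y) \<in> (edges T)\<^sup>*" using uniq step(2) by blast
      then have "(y, y) \<in> (edges T)\<^sup>+" using step(2) by (meson rtrancl_into_trancl2)
      then show False using step by blast
    qed
  qed
  show ?thesis
  proof (rule acyclicI, intro allI notI)
    fix x assume x: "(x, x) \<in> (edges T)\<^sup>+"
    then have "x \<in> nodes T" using sub by (meson SigmaD1 subsetD tranclD)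
    then show False using x no reach by blast
  qed
qed

lemma ex1_node_values:
  assumes T: "rooted_tree T"
  shows "\<exists>!b. is_node_values T fs \<alpha> b"
proof -
  have sub: "edges T \<subseteq> nodes T \<times> nodes T" and fin: "finite (edges T)"
    using T unfolding rooted_tree_def by (auto intro: finite_subset)
  have wf: "wf ((edges T)\<inverse>)"
    using finite_acyclic_wf_converse[OF fin rooted_tree_acyclic[OF T]] .
  define H where "H = (\<lambda>b v. if v \<notin> nodes T then undefined else if v \<in> leaves T then \<alpha> v
     else eval (fs v) (restrict b (children T v)))"
  define b where "b = wfrec ((edges T)\<inverse>) H"
  have cut: "restrict (cut b ((edges T)\<inverse>) v) (children T v) = restrict b (children T v)" for v
    by (auto simp: restrict_def cut_def children_def)
  have b: "b v = H b v" for v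
    using def_wfrec[OF eq_reflection[OF b_def] wf, of v] by (simp add: H_def cut)
  have "is_node_values T fs \<alpha> b"
    unfolding is_node_values_def
    by (auto simp: extensional_def internal_def leaves_def b[unfolded H_def])
  moreover have "c = b" if c: "is_node_values T fs \<alpha> c" for c
  proof
    fix v
    show "c v = b v"
      using wf
    proof (induction v rule: wf_induct_rule)
      case (less v)
      then have "restrict c (children T v) = restrict b (children T v)"
        by (auto simp: restrict_def children_def)
      then show ?case
        using c unfolding is_node_values_def b[of v] H_def
        by (auto simp: extensional_def internal_def)
    qed
  qed
  ultimately show ?thesis by blast
qed

end

theory Submission
  imports Defs
begin

text \<open>
  Well-behavedness is only needed for trees of depth two. It gives the recursion
  \<open>m\<^sub>s(f\<^sup>(\<^sup>k\<^sup>+\<^sup>1\<^sup>)) = max\<^sub>x min\<^sub>w \<Sum>\<^sub>i w(i) m\<^bsub>x(i)\<^esub>(f\<^sup>(\<^sup>k\<^sup>))\<close>, where \<open>x\<close> ranges over the inputs with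
  \<open>f(x) = s\<close> and \<open>w\<close> over the weights in \<open>A\<^sub>x(f)\<close>. So the pair \<open>(m\<^sub>0, m\<^sub>1)\<close> evolves under a monotone
  homogeneous map of the quadrant, and its growth rate is read off from vectors \<open>v = (1, t)\<close>.
  If \<open>\<kappa>\<close> exceeds the characteristic value, each selector admits a positive \<open>t\<close> with
  \<open>M v \<le> \<kappa> v\<close> for some profile matrix \<open>M\<close>. The two rows are chosen independently; the condition
  of row 0 is preserved when \<open>t\<close> decreases and that of row 1 when \<open>t\<close> increases, hence a minimax
  choice of \<open>t\<close> serves all selectors at once. If \<open>\<kappa>\<close> is below the value of a selector, the open
  sets of \<open>t\<close> violating \<open>\<kappa> v \<le> M v\<close> in row 0 and in row 1 are disjoint, so by connectedness they do
  not cover the positive half line, unless one of the two coordinate vectors already works.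

  An assemblage is not assumed to be invariant under renaming of indices. Composing with identity
  functions shows that renaming can be done up to pointwise domination of weights, which suffices.
\<close>


section \<open>Trees of depth two\<close>

text \<open>The inner functions may differ from one \<open>c\<close> to the next and their indices
  are merged by a plain union, since this is what a tree of depth two computes. The product form
  \<open>bfun_comp\<close> is recovered later by renaming.\<close>

definition two_level :: "'i bfun \<Rightarrow> ('i \<Rightarrow> 'i bfun) \<Rightarrow> 'i bfun" where
  "two_level h g =
     \<lparr> index = (\<Union>c\<in>index h. index (g c)),
       eval = (\<lambda>z \<in> cube (\<Union>c\<in>index h. index (g c)).
                 eval h (\<lambda>c \<in> index h. eval (g c) (restrict z (index (g c))))) \<rparr>"

lemma restrict_in_cube: "restrict x I \<in> cube I"
  by (simp add: cube_def)

text \<open>Apply both clauses of well-behavedness to the tree with a fresh root, the indices of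
  \<open>h\<close> as middle nodes and the indices of the \<open>g c\<close> as leaves. The
  disjointness assumptions make this graph a tree.\<close>

lemma well_behaved_two_level:
  fixes A :: "'i family"
  assumes wb: "well_behaved A" and asm: "assemblage A"
    and h: "is_bfun h" "index h \<noteq> {}"
    and g: "\<And>c. c \<in> index h \<Longrightarrow> is_bfun (g c)" "\<And>c. c \<in> index h \<Longrightarrow> index (g c) \<noteq> {}"
    and disj: "\<And>c c'. c \<in> index h \<Longrightarrow> c' \<in> index h \<Longrightarrow> c \<noteq> c' \<Longrightarrow> index (g c) \<inter> index (g c') = {}"
    and disj': "\<And>c. c \<in> index h \<Longrightarrow> index (g c) \<inter> index h = {}"
    and inf: "infinite (UNIV :: 'i set)"
    and z: "z \<in> cube (index (two_level h g))"
  defines "b \<equiv> (\<lambda>c \<in> index h. eval (g c) (restrict z (index (g c))))"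
  shows two_level_compose:
      "\<And>w u. w \<in> A h b \<Longrightarrow> (\<And>c. c \<in> index h \<Longrightarrow> u c \<in> A (g c) (restrict z (index (g c)))) \<Longrightarrow>
         \<exists>W \<in> A (two_level h g) z. \<forall>c\<in>index h. \<forall>j\<in>index (g c). W j = w c * u c j"
    and two_level_decompose:
      "\<And>W. W \<in> A (two_level h g) z \<Longrightarrow>
         \<exists>w \<in> A h b. \<exists>u. (\<forall>c\<in>index h. u c \<in> A (g c) (restrict z (index (g c)))) \<and>
           (\<Sum>c\<in>index h. w c * total (index (g c)) (u c)) \<le> total (index (two_level h g)) W"
proof -
  define C where "C = index h"
  define J where "J = (\<lambda>c. index (g c))"
  define L where "L = (\<Union>c\<in>C. J c)"
  have fC: "finite C" and fJ: "\<And>c. c \<in> C \<Longrightarrow> finite (J c)"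
    using h g by (auto simp: is_bfun_def C_def J_def)
  have neC: "C \<noteq> {}" and neJ: "\<And>c. c \<in> C \<Longrightarrow> J c \<noteq> {}"
    using h g by (auto simp: C_def J_def)
  have dJ: "\<And>c c' j. c \<in> C \<Longrightarrow> c' \<in> C \<Longrightarrow> j \<in> J c \<Longrightarrow> j \<in> J c' \<Longrightarrow> c = c'"
    using disj by (fastforce simp: C_def J_def)
  have dC: "\<And>c j. c \<in> C \<Longrightarrow> j \<in> J c \<Longrightarrow> j \<notin> C"
    using disj' by (fastforce simp: C_def J_def)
  have fL: "finite L" using fC fJ by (auto simp: L_def)
  \<comment> \<open>Nodes of the tree are themselves indices, so the root needs a name outside both
    lower levels; the infinite universe provides one.\<close>
  obtain r where r: "r \<notin> C \<union> L"
    using inf fC fL by (meson ex_new_if_finite finite_UnI)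
  have rC: "r \<notin> C" and rJ: "\<And>c. c \<in> C \<Longrightarrow> r \<notin> J c" using r by (auto simp: L_def)
  define T where "T = \<lparr> nodes = insert r (C \<union> L), top_node = r,
     edges = {r} \<times> C \<union> (SIGMA c:C. J c) \<rparr>"
  have E: "(x, y) \<in> edges T \<longleftrightarrow> x = r \<and> y \<in> C \<or> x \<in> C \<and> y \<in> J x" for x y
    by (auto simp: T_def)
  have chr: "children T r = C" using rC by (auto simp: children_def E)
  have chC: "children T c = J c" if "c \<in> C" for c
    using that rC by (auto simp: children_def E)
  have chL: "children T l = {}" if "l \<in> L" for l
    using that r dC by (auto simp: children_def E L_def)
  \<comment> \<open>Nonempty \<open>C\<close> and \<open>J c\<close> keep the root and the middle
    nodes from being leaves, so every leaf has depth two.\<close>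
  have lv: "leaves T = L"
    using chr chC chL neC neJ by (auto simp: leaves_def T_def)
  have it: "internal T = insert r C"
    using r dC unfolding internal_def lv by (auto simp: T_def L_def)
  have two: "(r, l) \<in> edges T ^^ 2" if "l \<in> L" for l
    using that E by (auto simp: numeral_2_eq_2 L_def relcomp_unfold)
  have rt: "rooted_tree T"
    unfolding rooted_tree_def
  proof (intro conjI ballI allI)
    show "finite (nodes T)" using fC fL by (simp add: T_def)
    show "top_node T \<in> nodes T" by (simp add: T_def)
    show "edges T \<subseteq> nodes T \<times> nodes T" by (auto simp: T_def L_def)
    show "(v, top_node T) \<notin> edges T" for v
      using rC rJ by (auto simp: T_def)
    show "\<exists>!v. (v, u) \<in> edges T" if "u \<in> nodes T - {top_node T}" for u
      using that dC dJ rC unfolding E by (auto simp: T_def L_def)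
    show "(top_node T, u) \<in> (edges T)\<^sup>*" if u: "u \<in> nodes T" for u
    proof -
      have "u = r \<or> u \<in> C \<or> u \<in> L" using u by (auto simp: T_def)
      moreover have "top_node T = r" by (simp add: T_def)
      moreover have "(r, u) \<in> (edges T)\<^sup>*" if "u \<in> C"
        using that E by blast
      moreover have "(r, u) \<in> (edges T)\<^sup>*" if "u \<in> L"
        using two[OF that] relpow_imp_rtrancl by blast
      ultimately show ?thesis by auto
    qed
  qed
  have ed: "equal_depth T"
    unfolding equal_depth_def lv using two by (auto simp: T_def)
  have pe: "path_edges T j = {(r, c), (c, j)}" if c: "c \<in> C" and j: "j \<in> J c" for c j
  proof -
    have rc: "(r, c) \<in> edges T" and cj: "(c, j) \<in> edges T" using c j by (auto simp: E)
    have par: "x = c" if "(x, j) \<in> edges T" for x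
      using that c j dC dJ unfolding E by blast
    have parc: "x = r" if "(x, c) \<in> edges T" for x
      using that c dC unfolding E by blast
    have nr: "(x, r) \<notin> edges T" for x using rC rJ by (auto simp: E)
    \<comment> \<open>Parents are unique and the root has none, so the ancestors of a leaf are the
      leaf, its middle node and the root.\<close>
    have up: "x = j \<or> x = c \<or> x = r" if "(x, j) \<in> (edges T)\<^sup>*" for x
      using that
      by (induction rule: converse_rtrancl_induct) (use par parc nr in blast)+
    show ?thesis
    proof (intro equalityI subsetI)
      fix e assume "e \<in> path_edges T j"
      then obtain v u where e: "e = (v, u)" "(v, u) \<in> edges T" "(u, j) \<in> (edges T)\<^sup>*"
        by (auto simp: path_edges_def)
      then show "e \<in> {(r, c), (c, j)}"
        using up[OF e(3)] par parc nr by auto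
    next
      fix e assume "e \<in> {(r, c), (c, j)}"
      then show "e \<in> path_edges T j"
        using rc cj by (auto simp: path_edges_def)
    qed
  qed
  define fs where "fs = (\<lambda>v. if v = r then h else g v)"
  have fsr: "fs r = h" and fsC: "\<And>c. c \<in> C \<Longrightarrow> fs c = g c" using rC by (auto simp: fs_def)
  have be: "bfun_ensemble T fs"
    unfolding bfun_ensemble_def it using h g chr chC fsr fsC
    by (auto simp: C_def J_def)
  \<comment> \<open>The circuit values written out level by level; uniqueness of node values then
    identifies them with the definite description in \<open>node_values\<close>.\<close>
  define B where "B = (\<lambda>y. \<lambda>v \<in> insert r (C \<union> L). if v \<in> L then y v
      else if v \<in> C then eval (g v) (restrict y (J v))
      else eval h (\<lambda>c\<in>C. eval (g c) (restrict y (J c))))"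
  have CL: "c \<notin> L" if "c \<in> C" for c using that dC by (auto simp: L_def)
  have BJ: "restrict (B y) (J c) = restrict y (J c)" if "c \<in> C" for c y
    using that by (auto simp: restrict_def L_def fun_eq_iff B_def)
  have BC: "restrict (B y) C = (\<lambda>c\<in>C. eval (g c) (restrict y (J c)))" for y
    using CL by (auto simp: restrict_def fun_eq_iff B_def)
  have Br: "B y r = eval h (\<lambda>c\<in>C. eval (g c) (restrict y (J c)))" for y
    using r by (simp add: B_def)
  have Bc: "B y c = eval (g c) (restrict y (J c))" if "c \<in> C" for y c
    using that CL by (simp add: B_def)
  have Bl: "B y l = y l" if "l \<in> L" for y l
    using that by (simp add: B_def)
  have Bext: "B y \<in> extensional (nodes T)" for y by (simp add: B_def T_def)
  have nv: "node_values T fs y = B y" for y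
    unfolding node_values_def
  proof (rule the1_equality[OF ex1_node_values[OF rt]])
    show "is_node_values T fs y (B y)"
      unfolding is_node_values_def it lv
    proof (intro conjI ballI)
      fix v assume "v \<in> insert r C"
      then show "B y v = eval (fs v) (restrict (B y) (children T v))"
        using chr chC fsr fsC Br Bc BC BJ by (metis insert_iff)
    qed (use Bl Bext in auto)
  qed
  have tb: "tree_bfun T fs = two_level h g"
    unfolding tree_bfun_def two_level_def lv nv
    by (simp add: T_def Br) (simp add: L_def C_def J_def)
  have z': "z \<in> cube (leaves T)"
    using z by (simp add: lv two_level_def L_def C_def J_def)
  have bv: "restrict (node_values T fs z) C = b"
    unfolding nv BC b_def by (simp add: C_def J_def)
  have zv: "restrict (node_values T fs z) (J c) = restrict z (J c)" if "c \<in> C" for c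
    unfolding nv using BJ[OF that] .
  have tw: "tree_weight T ws j = ws r c * ws c j" if "c \<in> C" "j \<in> J c" for ws c j
  proof -
    have "r \<noteq> c" using that rC by auto
    then show ?thesis
      using that pe[OF that] unfolding tree_weight_def lv by (auto simp: L_def)
  qed
  have cw: "compatible_weights A T fs z ws \<longleftrightarrow>
      ws r \<in> A h b \<and> (\<forall>c\<in>C. ws c \<in> A (g c) (restrict z (J c)))" for ws
  proof -
    have "ws r \<in> weights C" if "ws r \<in> A h b"
      using asm h that unfolding assemblage_def C_def b_def
      by (smt (verit, best) restrict_in_cube subsetD)
    moreover have "ws c \<in> weights (J c)" if "c \<in> C" "ws c \<in> A (g c) (restrict z (J c))" for c
      using asm g that unfolding assemblage_def C_def J_def
      by (smt (verit, best) restrict_in_cube subsetD)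
    ultimately show ?thesis
      unfolding compatible_weights_def it
      using chr chC fsr fsC bv zv by auto
  qed
  note WB = wb[unfolded well_behaved_def, rule_format, OF rt ed be z', unfolded tb lv]
  {
    fix w u assume w: "w \<in> A h b"
      and u: "\<And>c. c \<in> index h \<Longrightarrow> u c \<in> A (g c) (restrict z (index (g c)))"
    define ws where "ws = (\<lambda>v. if v = r then w else u v)"
    have wsC: "c \<in> C \<Longrightarrow> ws c = u c" for c using rC by (auto simp: ws_def)
    have "compatible_weights A T fs z ws"
      unfolding cw using w u rC by (auto simp: ws_def C_def J_def)
    then have "tree_weight T ws \<in> A (two_level h g) z" using WB by blast
    moreover have "tree_weight T ws j = w c * u c j" if "c \<in> C" "j \<in> J c" for c j
      using tw[OF that, of ws] wsC that by (simp add: ws_def)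
    ultimately show "\<exists>W \<in> A (two_level h g) z. \<forall>c\<in>index h. \<forall>j\<in>index (g c). W j = w c * u c j"
      unfolding C_def J_def by blast
  }
  {
    fix W assume "W \<in> A (two_level h g) z"
    then obtain ws where ws: "compatible_weights A T fs z ws"
      and le: "total L (tree_weight T ws) \<le> total L W" using WB by blast
    \<comment> \<open>The leaves split into disjoint blocks, one for each middle node
      \<open>c\<close>, and \<open>ws r c\<close> is a common factor of its block.\<close>
    have "total L (tree_weight T ws) = (\<Sum>c\<in>C. \<Sum>j\<in>J c. tree_weight T ws j)"
      unfolding total_def L_def using fC fJ dJ by (intro sum.UNION_disjoint) auto
    also have "\<dots> = (\<Sum>c\<in>C. ws r c * total (J c) (ws c))"
      by (simp add: tw total_def sum_distrib_left)
    finally have "(\<Sum>c\<in>index h. ws r c * total (index (g c)) (ws c))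
        \<le> total (index (two_level h g)) W"
      using le by (simp add: C_def J_def L_def two_level_def)
    then show "\<exists>w \<in> A h b. \<exists>u. (\<forall>c\<in>index h. u c \<in> A (g c) (restrict z (index (g c)))) \<and>
           (\<Sum>c\<in>index h. w c * total (index (g c)) (u c)) \<le> total (index (two_level h g)) W"
      using ws unfolding cw C_def J_def by blast
  }
qed

section \<open>Spectral radius of nonnegative two-by-two matrices\<close>

text \<open>Frees the spectral estimates from weights: any real matrix indexed by bits, stored in
  the format of \<open>profile_matrix\<close>.\<close>

definition bool_mat :: "(bool \<Rightarrow> bool \<Rightarrow> real) \<Rightarrow> complex mat" where
  "bool_mat P = mat 2 2 (\<lambda>(s, t). complex_of_real (P (s = 1) (t = 1)))"

lemma bool_mat_carrier [simp]: "bool_mat P \<in> carrier_mat 2 2"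
  by (simp add: bool_mat_def)

lemma bool_mat_mult_vec_eq_iff:
  assumes "x \<in> carrier_vec 2"
  shows "bool_mat P *\<^sub>v x = z \<cdot>\<^sub>v x \<longleftrightarrow>
    of_real (P False False) * x $ 0 + of_real (P False True) * x $ 1 = z * x $ 0 \<and>
    of_real (P True False) * x $ 0 + of_real (P True True) * x $ 1 = z * x $ 1"
proof -
  have [simp]: "{0..<2::nat} = {0, 1}" by auto
  have "bool_mat P *\<^sub>v x = vec 2 (\<lambda>i. if i = 0
      then of_real (P False False) * x $ 0 + of_real (P False True) * x $ 1
      else of_real (P True False) * x $ 0 + of_real (P True True) * x $ 1)"
    using assms by (intro eq_vecI) (auto simp: bool_mat_def scalar_prod_def less_2_cases_iff)
  then show ?thesis
    using assms by (auto simp: vec_eq_iff less_2_cases_iff)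
qed

text \<open>The Collatz-Wielandt upper bound. In a row where an eigenvector is largest relative to
  \<open>v\<close>, the triangle inequality bounds the modulus of its eigenvalue by
  \<open>\<kappa>\<close>.\<close>

lemma spectral_radius_bool_mat_le:
  assumes P: "\<And>s t. P s t \<ge> 0" and v: "\<And>s. v s > 0"
    and le: "\<And>s. P s False * v False + P s True * v True \<le> \<kappa> * v s"
  shows "spectral_radius (bool_mat P) \<le> \<kappa>"
proof -
  obtain z where z: "z \<in> spectrum (bool_mat P)" "spectral_radius (bool_mat P) = cmod z"
    using spectral_radius_mem_max(1)[OF bool_mat_carrier] by auto
  then obtain x where x: "x \<in> carrier_vec 2" "x \<noteq> 0\<^sub>v 2" "bool_mat P *\<^sub>v x = z \<cdot>\<^sub>v x"
    unfolding spectrum_def eigenvalue_def eigenvector_def by (auto simp: bool_mat_def)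
  define y where "y = (\<lambda>s::bool. x $ (if s then 1 else 0))"
  have eq: "of_real (P s False) * y False + of_real (P s True) * y True = z * y s" for s
    using x(3) unfolding bool_mat_mult_vec_eq_iff[OF x(1)] by (cases s) (auto simp: y_def)
  \<comment> \<open>This is the maximum norm of \<open>y\<close> weighted by \<open>v\<close>;
    below, \<open>s\<close> is a coordinate that attains it.\<close>
  define r where "r = max (cmod (y False) / v False) (cmod (y True) / v True)"
  have ry: "cmod (y s) \<le> r * v s" for s
    using v[of s] by (cases s) (auto simp: r_def field_simps max_def)
  obtain s where s: "cmod (y s) = r * v s"
  proof -
    have "r = cmod (y False) / v False \<or> r = cmod (y True) / v True" by (auto simp: r_def max_def)
    then show ?thesis
      using that v[of False] v[of True] by (metis less_irrefl nonzero_eq_divide_eq)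
  qed
  have "y False \<noteq> 0 \<or> y True \<noteq> 0"
    using x(1,2) by (auto simp: y_def vec_eq_iff less_2_cases_iff)
  then have r: "r > 0"
    using v[of False] v[of True] by (auto simp: r_def less_max_iff_disj)
  have "cmod z * (r * v s) = cmod (z * y s)" by (simp add: s norm_mult)
  also have "\<dots> \<le> P s False * cmod (y False) + P s True * cmod (y True)"
    unfolding eq[symmetric] by (rule order_trans[OF norm_triangle_ineq]) (simp add: norm_mult P)
  also have "\<dots> \<le> P s False * (r * v False) + P s True * (r * v True)"
    by (intro add_mono mult_left_mono ry P)
  also have "\<dots> = r * (P s False * v False + P s True * v True)" by (simp add: algebra_simps)
  also have "\<dots> \<le> r * (\<kappa> * v s)" using le r by (intro mult_left_mono) auto
  finally have "cmod z * (r * v s) \<le> \<kappa> * (r * v s)" by (simp add: algebra_simps)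
  then show ?thesis using r v[of s] z(2) by simp
qed

text \<open>A real eigenpair is also a complex one, and \<open>\<mu>\<close> is at most its modulus,
  whatever its sign.\<close>

lemma eigenvalue_le_spectral_radius:
  fixes p q \<mu> :: real and P :: "bool \<Rightarrow> bool \<Rightarrow> real"
  assumes "p \<noteq> 0 \<or> q \<noteq> 0"
    and "P False False * p + P False True * q = \<mu> * p"
    and "P True False * p + P True True * q = \<mu> * q"
  shows "\<mu> \<le> spectral_radius (bool_mat P)"
proof -
  define x where "x = vec 2 (\<lambda>i. complex_of_real (if i = 0 then p else q))"
  have x: "x \<in> carrier_vec 2" "x $ 0 = p" "x $ 1 = q"
    by (simp_all add: x_def)
  have "x \<noteq> 0\<^sub>v 2" using assms(1) x by auto
  moreover have "bool_mat P *\<^sub>v x = complex_of_real \<mu> \<cdot>\<^sub>v x"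
    unfolding bool_mat_mult_vec_eq_iff[OF x(1)] x
    using assms(2,3) by (metis of_real_add of_real_mult)
  ultimately have "complex_of_real \<mu> \<in> spectrum (bool_mat P)"
    using x(1) unfolding spectrum_def eigenvalue_def eigenvector_def by (auto simp: bool_mat_def)
  from spectral_radius_mem_max(2)[OF bool_mat_carrier pos2 imageI[OF this]]
  have "cmod (complex_of_real \<mu>) \<le> spectral_radius (bool_mat P)" .
  then show ?thesis by simp
qed

text \<open>A converse to the Collatz-Wielandt bound, with the vector normalised to
  \<open>(1, t)\<close>. If \<open>P False True\<close> is positive, equality in row 0 fixes
  \<open>t\<close>, and row 1 follows from the characteristic equation. If it is zero, the matrix is
  triangular and every large \<open>t\<close> works.\<close>

lemma spectral_radius_bool_mat_less_imp:
  assumes P: "\<And>s t. P s t \<ge> 0" and less: "spectral_radius (bool_mat P) < \<kappa>"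
  obtains t where "t > 0" "P False False + P False True * t \<le> \<kappa>"
    "P True False + P True True * t \<le> \<kappa> * t"
proof -
  define a b c d where abcd: "a = P False False" "b = P False True" "c = P True False" "d = P True True"
  have nn: "a \<ge> 0" "b \<ge> 0" "c \<ge> 0" "d \<ge> 0" using P by (auto simp: abcd)
  have ev: "\<mu> < \<kappa>" if "p \<noteq> 0 \<or> q \<noteq> 0" "a * p + b * q = \<mu> * p" "c * p + d * q = \<mu> * q" for p q \<mu>
    using eigenvalue_le_spectral_radius[of p q P \<mu>] that less by (simp add: abcd)
  show thesis
  proof (cases "b = 0")
    case True
    have d: "d < \<kappa>" using ev[of 0 1 d] True by simp
    have a: "a < \<kappa>"
    proof (cases "a = d")
      case False
      \<comment> \<open>For a triangular matrix with distinct diagonal entries,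
        \<open>(a - d, c)\<close> is an eigenvector for \<open>a\<close>.\<close>
      then show ?thesis using ev[of "a - d" c a] True by (simp add: algebra_simps)
    qed (use d in simp)
    \<comment> \<open>The quotient solves row 1 with equality; adding 1 keeps \<open>t\<close>
      positive when \<open>c = 0\<close>.\<close>
    define t where "t = c / (\<kappa> - d) + 1"
    have "(\<kappa> - d) * t = c + (\<kappa> - d)" using d by (simp add: t_def distrib_left)
    then have "c + d * t \<le> \<kappa> * t" using d by (simp add: left_diff_distrib)
    moreover have "t > 0" using nn d by (simp add: t_def add_nonneg_pos)
    ultimately show thesis using that[of t] a True by (simp add: abcd)
  next
    case False
    then have b: "b > 0" using nn by simp
    define D where "D = sqrt ((a - d)\<^sup>2 + 4 * b * c)"
    \<comment> \<open>The larger root of the characteristic polynomial;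
      \<open>(b, \<mu> - a)\<close> is an eigenvector for it.\<close>
    define \<mu> where "\<mu> = (a + d + D) / 2"
    have D2: "D\<^sup>2 = (a - d)\<^sup>2 + 4 * b * c" using nn by (simp add: D_def)
    have Da: "\<bar>a - d\<bar> \<le> D"
      unfolding D_def by (rule real_le_rsqrt) (use nn in simp)
    have ch: "(\<mu> - a) * (\<mu> - d) = b * c"
      using D2 unfolding \<mu>_def by (simp add: field_simps power2_eq_square)
    have "\<mu> < \<kappa>"
      using ev[of b "\<mu> - a" \<mu>] b ch by (simp add: algebra_simps)
    have \<mu>: "a \<le> \<mu>" "d \<le> \<mu>" using Da by (auto simp: \<mu>_def abs_le_iff)
    have "c * b \<le> (\<kappa> - a) * (\<kappa> - d)"
      unfolding mult.commute[of c] ch[symmetric] using \<mu> \<open>\<mu> < \<kappa>\<close> by (intro mult_mono) auto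
    then have "c \<le> (\<kappa> - a) * (\<kappa> - d) / b"
      using b by (simp add: pos_le_divide_eq)
    \<comment> \<open>The solution of \<open>a + b * t = \<kappa>\<close>, that is, of row 0 with
      equality.\<close>
    moreover define t where "t = (\<kappa> - a) / b"
    ultimately have "c \<le> (\<kappa> - d) * t" by (simp add: mult.commute)
    then have "c + d * t \<le> \<kappa> * t" by (simp add: left_diff_distrib)
    moreover have "a + b * t = \<kappa>" "t > 0" using b \<mu> \<open>\<mu> < \<kappa>\<close> by (simp_all add: t_def)
    ultimately show thesis using that[of t] by (simp add: abcd)
  qed
qed

section \<open>Profile matrices and weighted sums\<close>

text \<open>Grouping indices by the bit of \<open>x\<close> exhibits the weighted sum as a row of a
  profile matrix applied to \<open>v\<close>. This links the recursion for compositions to the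
  spectral radius.\<close>

lemma sum_split_bit:
  fixes w :: "'i \<Rightarrow> real"
  assumes "finite I"
  shows "(\<Sum>i\<in>I. w i * v (x i)) =
    (\<Sum>j\<in>{j\<in>I. x j = False}. w j) * v False + (\<Sum>j\<in>{j\<in>I. x j = True}. w j) * v True"
proof -
  have "(\<Sum>i\<in>I. w i * v (x i)) = (\<Sum>i\<in>I. if x i then w i * v True else w i * v False)"
    by (intro sum.cong) auto
  also have "\<dots> = (\<Sum>j\<in>{j\<in>I. x j = False}. w j) * v False + (\<Sum>j\<in>{j\<in>I. x j = True}. w j) * v True"
    using assms by (simp add: sum.If_cases sum_distrib_right Int_def Collect_neg_eq)
  finally show ?thesis .
qed

lemma profile_matrix_eq:
  "profile_matrix I \<alpha> w = bool_mat (\<lambda>s t. \<Sum>j\<in>{j\<in>I. \<alpha> s j = t}. w s j)"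
  by (simp add: profile_matrix_def bool_mat_def)

lemma spectral_radius_profile_le:
  assumes "finite I" "\<And>s. w s \<in> weights I" "\<And>s. v s > 0"
    and "\<And>s. (\<Sum>i\<in>I. w s i * v (\<alpha> s i)) \<le> \<kappa> * v s"
  shows "spectral_radius (profile_matrix I \<alpha> w) \<le> \<kappa>"
  unfolding profile_matrix_eq
  using assms(2-4) sum_split_bit[OF assms(1)]
  by (intro spectral_radius_bool_mat_le[where v = v]) (auto simp: weights_def intro!: sum_nonneg)

lemma spectral_radius_profile_less_imp:
  assumes "finite I" "\<And>s. w s \<in> weights I"
    and "spectral_radius (profile_matrix I \<alpha> w) < \<kappa>"
  obtains t where "t > 0" "(\<Sum>i\<in>I. w False i * (if \<alpha> False i then t else 1)) \<le> \<kappa>"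
    "(\<Sum>i\<in>I. w True i * (if \<alpha> True i then t else 1)) \<le> \<kappa> * t"
proof (rule spectral_radius_bool_mat_less_imp[OF _ assms(3)[unfolded profile_matrix_eq]])
  show "0 \<le> (\<Sum>j | j \<in> I \<and> \<alpha> s j = t. w s j)" for s t
    using assms(2) by (auto simp: weights_def intro!: sum_nonneg)
qed (use sum_split_bit[OF assms(1), of _ "\<lambda>b. if b then _ else 1"] that in simp)

lemma spectral_radius_profile_nonneg: "spectral_radius (profile_matrix I \<alpha> w) \<ge> 0"
proof -
  obtain z where "spectral_radius (profile_matrix I \<alpha> w) = cmod z"
    using spectral_radius_mem_max(1)[OF bool_mat_carrier pos2] unfolding profile_matrix_eq by blast
  then show ?thesis by simp
qed

section \<open>A minimax principle for finite families\<close>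

text \<open>Take the minimum over \<open>x\<close> of the maximum over \<open>y\<close> of the
  witnesses \<open>\<tau> x y\<close>. For each \<open>x\<close> it lies below some witness, from
  which \<open>P x\<close> passes down; at the minimising \<open>x0\<close> it lies above all
  witnesses, from which every \<open>Q y\<close> passes up.\<close>

lemma finite_minimax_common_point:
  fixes P :: "'x \<Rightarrow> real \<Rightarrow> bool"
  assumes fin: "finite X" "X \<noteq> {}" "finite Y" "Y \<noteq> {}"
    and ex: "\<And>x y. x \<in> X \<Longrightarrow> y \<in> Y \<Longrightarrow> \<exists>t>0. P x t \<and> Q y t"
    and P: "\<And>x s t. x \<in> X \<Longrightarrow> 0 < s \<Longrightarrow> s \<le> t \<Longrightarrow> P x t \<Longrightarrow> P x s"
    and Q: "\<And>y s t. y \<in> Y \<Longrightarrow> 0 < s \<Longrightarrow> s \<le> t \<Longrightarrow> Q y s \<Longrightarrow> Q y t"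
  shows "\<exists>t>0. (\<forall>x\<in>X. P x t) \<and> (\<forall>y\<in>Y. Q y t)"
proof -
  obtain \<tau> where \<tau>: "\<And>x y. x \<in> X \<Longrightarrow> y \<in> Y \<Longrightarrow> \<tau> x y > 0 \<and> P x (\<tau> x y) \<and> Q y (\<tau> x y)"
    using ex by metis
  define m where "m = (\<lambda>x. Max (\<tau> x ` Y))"
  have m_in: "m x \<in> \<tau> x ` Y" for x unfolding m_def using fin by (intro Max_in) auto
  have m_ge: "\<tau> x y \<le> m x" if "y \<in> Y" for x y unfolding m_def using fin that by (intro Max_ge) auto
  define t where "t = Min (m ` X)"
  have "t \<in> m ` X" unfolding t_def using fin by (intro Min_in) auto
  then obtain x0 where x0: "x0 \<in> X" "t = m x0" by blast
  have t_le: "t \<le> m x" if "x \<in> X" for x unfolding t_def using fin that by (intro Min_le) auto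
  have t0: "t > 0" using m_in[of x0] x0 \<tau> by auto
  moreover have "P x t" if "x \<in> X" for x
    using m_in[of x] t_le[OF that] P[OF that t0] \<tau> that by auto
  moreover have "Q y t" if "y \<in> Y" for y
    using m_ge[OF that, of x0] Q[OF that] \<tau>[OF x0(1) that] x0 by auto
  ultimately show ?thesis by blast
qed

section \<open>Renaming and composition\<close>

definition id_bfun :: "'i \<Rightarrow> 'i bfun" where
  "id_bfun u = \<lparr> index = {u}, eval = (\<lambda>x \<in> cube {u}. x u) \<rparr>"

definition relabel :: "('i \<Rightarrow> 'j) \<Rightarrow> 'i bfun \<Rightarrow> 'j bfun" where
  "relabel \<sigma> f =
     \<lparr> index = \<sigma> ` index f,
       eval = (\<lambda>z \<in> cube (\<sigma> ` index f). eval f (\<lambda>i \<in> index f. z (\<sigma> i))) \<rparr>"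

lemma index_id_bfun [simp]: "index (id_bfun u) = {u}"
  by (simp add: id_bfun_def)

lemma is_bfun_id_bfun [simp]: "is_bfun (id_bfun u)"
  by (simp add: id_bfun_def is_bfun_def)

lemma index_relabel [simp]: "index (relabel \<sigma> f) = \<sigma> ` index f"
  by (simp add: relabel_def)

lemma is_bfun_relabel: "is_bfun f \<Longrightarrow> is_bfun (relabel \<sigma> f)"
  by (simp add: relabel_def is_bfun_def)

lemma eval_relabel_restrict:
  "eval (relabel \<sigma> f) (restrict z (\<sigma> ` index f)) = eval f (\<lambda>i \<in> index f. z (\<sigma> i))"
proof -
  have "(\<lambda>i \<in> index f. restrict z (\<sigma> ` index f) (\<sigma> i)) = (\<lambda>i \<in> index f. z (\<sigma> i))"
    by (rule restrict_ext) simp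
  then show ?thesis
    unfolding relabel_def by (simp only: bfun.simps restrict_apply' restrict_in_cube)
qed

lemma relabel_cong:
  assumes "\<And>i. i \<in> index f \<Longrightarrow> \<sigma> i = \<tau> i"
  shows "relabel \<sigma> f = relabel \<tau> f"
proof -
  have "\<sigma> ` index f = \<tau> ` index f" using assms by auto
  moreover have "(\<lambda>i \<in> index f. z (\<sigma> i)) = (\<lambda>i \<in> index f. z (\<tau> i))" for z :: "_ \<Rightarrow> bool"
    using assms by (auto simp: restrict_def fun_eq_iff)
  ultimately show ?thesis unfolding relabel_def by simp
qed

lemma relabel_relabel: "relabel \<rho> (relabel \<sigma> f) = relabel (\<rho> \<circ> \<sigma>) f"
proof -
  have "eval f (\<lambda>i \<in> index f. (\<lambda>k \<in> \<sigma> ` index f. z (\<rho> k)) (\<sigma> i)) = eval f (\<lambda>i \<in> index f. z (\<rho> (\<sigma> i)))"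
    for z :: "_ \<Rightarrow> bool"
    by (rule arg_cong[where f = "eval f"]) (auto simp: restrict_def fun_eq_iff)
  then show ?thesis unfolding relabel_def by (simp add: restrict_in_cube image_image)
qed

text \<open>Extensionality of \<open>eval f\<close>, which is part of \<open>is_bfun\<close>, turns
  agreement on the cube into equality. Equality is what allows rewriting inside
  \<open>A\<close>.\<close>

lemma relabel_id:
  assumes "is_bfun f" "\<And>i. i \<in> index f \<Longrightarrow> \<sigma> i = i"
  shows "relabel \<sigma> f = f"
proof -
  have "relabel \<sigma> f = relabel id f" using assms by (intro relabel_cong) simp
  also have "\<dots> = f"
  proof -
    have "(\<lambda>i \<in> index f. z i) = z" if "z \<in> cube (index f)" for z :: "_ \<Rightarrow> bool"
      using that by (simp add: cube_def)
    then have "restrict (\<lambda>z. eval f (restrict z (index f))) (cube (index f)) = eval f"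
      using assms(1) unfolding is_bfun_def by (auto simp: fun_eq_iff restrict_def extensional_def)
    then show ?thesis by (simp add: relabel_def)
  qed
  finally show ?thesis .
qed

lemma eval_id_bfun [simp]: "eval (id_bfun u) (restrict z {u}) = z u"
  by (simp add: id_bfun_def restrict_in_cube)

text \<open>Identity functions placed below \<open>f\<close> realise a renaming as a tree
  composition, so well-behavedness applies to \<open>relabel\<close>.\<close>

lemma two_level_id_bfun: "two_level f (\<lambda>i. id_bfun (\<sigma> i)) = relabel \<sigma> f"
proof -
  have "(\<Union>c\<in>index f. {\<sigma> c}) = \<sigma> ` index f" by auto
  then show ?thesis unfolding two_level_def relabel_def by simp
qed

text \<open>\<open>Pr (Atom undefined)\<close> is injective but hits no atom; on a finite type it
  would be onto.\<close>

lemma infinite_UNIV_label: "infinite (UNIV :: 'a label set)"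
proof
  assume "finite (UNIV :: 'a label set)"
  then have "surj (Pr (Atom undefined :: 'a label))"
    by (intro finite_UNIV_inj_surj) (auto simp: inj_def)
  then show False by (metis label.distinct(1) surjD)
qed

text \<open>Supplies names that clash with none of the indices in use, as different levels of a tree
  must not overlap.\<close>

lemma ex_fresh_inj:
  assumes "finite I" "finite S"
  shows "\<exists>c :: 'b \<Rightarrow> 'a label. inj_on c I \<and> c ` I \<inter> S = {}"
proof -
  obtain B where B: "finite B" "card B = card I" "B \<subseteq> UNIV - S"
    using infinite_arbitrarily_large[of "UNIV - S"] infinite_UNIV_label assms(2) by (metis Diff_infinite_finite)
  then obtain c where "bij_betw c I B" using assms(1) by (metis finite_same_card_bij)
  then show ?thesis using B(3) by (auto simp: bij_betw_def)
qed

section \<open>Transport of weights along renamings\<close>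

locale well_behaved_assemblage =
  fixes A :: "'a label family"
  assumes asm: "assemblage A" and wb: "well_behaved A"
begin

lemma family_nonempty: "is_bfun f \<Longrightarrow> x \<in> cube (index f) \<Longrightarrow> A f x \<noteq> {}"
  and family_weights: "is_bfun f \<Longrightarrow> x \<in> cube (index f) \<Longrightarrow> w \<in> A f x \<Longrightarrow> w \<in> weights (index f)"
  and family_compact: "is_bfun f \<Longrightarrow> x \<in> cube (index f) \<Longrightarrow> compactin (powertop_real (index f)) (A f x)"
  using asm unfolding assemblage_def by blast+

lemma family_nonneg:
  "is_bfun f \<Longrightarrow> x \<in> cube (index f) \<Longrightarrow> w \<in> A f x \<Longrightarrow> i \<in> index f \<Longrightarrow> w i \<ge> 0"
  using family_weights by (fastforce simp: weights_def)

text \<open>The coordinate \<open>u\<close> is continuous, so it maps the family to a nonempty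
  compact set of reals, which has a least element.\<close>

lemma id_bfun_min_weight:
  assumes "x \<in> cube {u}"
  obtains p where "p \<in> A (id_bfun u) x" "\<And>q. q \<in> A (id_bfun u) x \<Longrightarrow> p u \<le> q u"
proof -
  have "compactin euclideanreal ((\<lambda>w. w u) ` A (id_bfun u) x)"
    using family_compact[of "id_bfun u" x] assms
    by (intro image_compactin[where X = "powertop_real {u}"] continuous_map_product_projection) auto
  then have "compact ((\<lambda>w. w u) ` A (id_bfun u) x)" by simp
  moreover have "(\<lambda>w. w u) ` A (id_bfun u) x \<noteq> {}"
    using family_nonempty[of "id_bfun u" x] assms by simp
  ultimately obtain m where m: "m \<in> (\<lambda>w. w u) ` A (id_bfun u) x"
      "\<forall>t \<in> (\<lambda>w. w u) ` A (id_bfun u) x. m \<le> t"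
    using compact_attains_inf[of "(\<lambda>w. w u) ` A (id_bfun u) x"] by blast
  from m(1) obtain p where "p \<in> A (id_bfun u) x" "m = p u" by blast
  then show thesis using that[of p] m(2) by simp
qed

text \<open>If the minimum \<open>p\<close> at \<open>u\<close> and the minimum \<open>q\<close> at another index \<open>v\<close> are attained, splitting
  the weight \<open>q\<close> along the chain \<open>u\<close>, \<open>v\<close> gives \<open>p q \<le> q\<close>; when \<open>q = 0\<close>, composing in the other order
  puts the weight 0 at \<open>u\<close>.\<close>

lemma id_bfun_weight_le_1:
  assumes x: "x \<in> cube {u}"
  shows "\<exists>p \<in> A (id_bfun u) x. p u \<le> 1"
proof -
  \<comment> \<open>\<open>y v\<close> carries the single bit of \<open>x\<close> at the index
    \<open>v\<close>, so the identities at all indices see the same value.\<close>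
  define y where "y = (\<lambda>v :: 'a label. \<lambda>_\<in>{v}. x u)"
  have y: "y v \<in> cube {v}" for v by (simp add: y_def cube_def)
  have xy: "x = y u" using x by (auto simp: y_def cube_def fun_eq_iff PiE_iff extensional_def)
  obtain v where v: "v \<noteq> u"
    using infinite_UNIV_label by (metis ex_new_if_finite finite.emptyI finite.insertI insertI1)
  have tl: "two_level (id_bfun s) (\<lambda>_. id_bfun t) = id_bfun t" if "s \<noteq> t" for s t :: "'a label"
    using two_level_id_bfun[of "id_bfun s" "\<lambda>_. t"]
    by (simp add: relabel_def id_bfun_def restrict_in_cube cong: restrict_cong)
  have bt: "(\<lambda>c\<in>{s}. (y t) t) = y s" for s t by (simp add: y_def)
  have ry: "restrict (y t) {t} = y t" for t by (simp add: y_def)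
  have ey: "eval (id_bfun t) (y t) = y t t" for t using eval_id_bfun[of t "y t"] ry by simp
  have comp: "\<exists>W \<in> A (id_bfun t) (y t). W t = p s * q t"
    if "s \<noteq> t" "p \<in> A (id_bfun s) (y s)" "q \<in> A (id_bfun t) (y t)" for s t p q
    using two_level_compose[OF wb asm, of "id_bfun s" "\<lambda>_. id_bfun t" "y t" p "\<lambda>_. q"]
      that y infinite_UNIV_label tl[OF that(1)] bt ry ey by simp
  have decomp: "\<exists>p \<in> A (id_bfun s) (y s). \<exists>q \<in> A (id_bfun t) (y t). p s * q t \<le> W t"
    if "s \<noteq> t" "W \<in> A (id_bfun t) (y t)" for s t W
    using two_level_decompose[OF wb asm, of "id_bfun s" "\<lambda>_. id_bfun t" "y t" W]
      that y infinite_UNIV_label tl[OF that(1)] bt ry ey by (auto simp: total_def)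
  obtain p where p: "p \<in> A (id_bfun u) (y u)" "\<And>q. q \<in> A (id_bfun u) (y u) \<Longrightarrow> p u \<le> q u"
    using id_bfun_min_weight[OF y] by blast
  obtain q where q: "q \<in> A (id_bfun v) (y v)" "\<And>r. r \<in> A (id_bfun v) (y v) \<Longrightarrow> q v \<le> r v"
    using id_bfun_min_weight[OF y] by blast
  have p0: "p u \<ge> 0" and q0: "q v \<ge> 0"
    using family_nonneg[of "id_bfun u" "y u" p u] family_nonneg[of "id_bfun v" "y v" q v] p q y by auto
  obtain p' q' where pq: "p' \<in> A (id_bfun u) (y u)" "q' \<in> A (id_bfun v) (y v)" "p' u * q' v \<le> q v"
    using decomp[OF v[symmetric] q(1)] by blast
  have "p u * q v \<le> p' u * q' v"
    using p0 q0 p(2)[OF pq(1)] q(2)[OF pq(2)] by (intro mult_mono) auto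
  then have "p u * q v \<le> q v" using pq(3) by simp
  then consider "q v = 0" | "p u \<le> 1" using q0 by (metis mult_le_cancel_right2 order_le_less)
  then show ?thesis
  proof cases
    case 1
    then obtain W where "W \<in> A (id_bfun u) x" "W u = 0" using comp[OF v q(1) p(1)] xy by auto
    then show ?thesis by (intro bexI[of _ W]) auto
  next
    case 2
    then show ?thesis using p xy by auto
  qed
qed

text \<open>Below each \<open>i\<close> hang the identity at \<open>\<sigma> i\<close> with a weight
  of at most 1; the composed weight at \<open>\<sigma> i\<close> is \<open>w i\<close> times that
  weight. Old and new indices are nodes of one tree here, hence the disjointness.\<close>

lemma relabel_transport_disjoint:
  assumes f: "is_bfun f" "index f \<noteq> {}" and \<sigma>: "inj_on \<sigma> (index f)" "\<sigma> ` index f \<inter> index f = {}"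
    and z: "z \<in> cube (\<sigma> ` index f)" and w: "w \<in> A f (\<lambda>i \<in> index f. z (\<sigma> i))"
  shows "\<exists>W \<in> A (relabel \<sigma> f) z. \<forall>i\<in>index f. W (\<sigma> i) \<le> w i"
proof -
  have "\<exists>p \<in> A (id_bfun (\<sigma> i)) (restrict z {\<sigma> i}). p (\<sigma> i) \<le> 1" for i
    by (rule id_bfun_weight_le_1[OF restrict_in_cube])
  then obtain u where u: "u i \<in> A (id_bfun (\<sigma> i)) (restrict z {\<sigma> i})" "u i (\<sigma> i) \<le> 1" for i
    by metis
  have w0: "w i \<ge> 0" if "i \<in> index f" for i
    using family_nonneg[OF f(1) restrict_in_cube w that] .
  have "\<exists>W \<in> A (two_level f (\<lambda>i. id_bfun (\<sigma> i))) z.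
      \<forall>i\<in>index f. \<forall>j\<in>index (id_bfun (\<sigma> i)). W j = w i * u i j"
    using f \<sigma> z w u infinite_UNIV_label
    by (intro two_level_compose[OF wb asm]) (auto simp: inj_on_def two_level_id_bfun)
  then obtain W where W: "W \<in> A (relabel \<sigma> f) z" "\<And>i. i \<in> index f \<Longrightarrow> W (\<sigma> i) = w i * u i (\<sigma> i)"
    unfolding two_level_id_bfun by auto
  have "W (\<sigma> i) \<le> w i" if "i \<in> index f" for i
    using W(2)[OF that] u(2)[of i] w0[OF that] by (simp add: mult_left_le)
  then show ?thesis using W(1) by blast
qed

text \<open>When old and new names overlap, pass through fresh names: \<open>\<tau>\<close> leads to
  them and \<open>\<rho>\<close> from them to the targets, and each of the two moves has disjoint
  source and range.\<close>

lemma relabel_transport: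
  assumes f: "is_bfun f" "index f \<noteq> {}" and \<sigma>: "inj_on \<sigma> (index f)"
    and z: "z \<in> cube (\<sigma> ` index f)" and w: "w \<in> A f (\<lambda>i \<in> index f. z (\<sigma> i))"
  shows "\<exists>W \<in> A (relabel \<sigma> f) z. \<forall>i\<in>index f. W (\<sigma> i) \<le> w i"
proof -
  have fin: "finite (index f)" using f by (simp add: is_bfun_def)
  then obtain \<tau> :: "'a label \<Rightarrow> 'a label"
    where \<tau>: "inj_on \<tau> (index f)" "\<tau> ` index f \<inter> (index f \<union> \<sigma> ` index f) = {}"
    using ex_fresh_inj[OF fin, of "index f \<union> \<sigma> ` index f"] by auto
  define \<rho> where "\<rho> = \<sigma> \<circ> inv_into (index f) \<tau>"
  have \<rho>: "\<rho> (\<tau> i) = \<sigma> i" if "i \<in> index f" for i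
    using that \<tau>(1) by (simp add: \<rho>_def)
  have im: "\<rho> ` \<tau> ` index f = \<sigma> ` index f" using \<rho> by force
  define y where "y = (\<lambda>k \<in> \<tau> ` index f. z (\<rho> k))"
  have e: "(\<lambda>i \<in> index f. y (\<tau> i)) = (\<lambda>i \<in> index f. z (\<sigma> i))"
    by (auto simp: y_def \<rho> restrict_def fun_eq_iff)
  have "y \<in> cube (\<tau> ` index f)" "\<tau> ` index f \<inter> index f = {}"
    using \<tau>(2) by (auto simp: y_def restrict_in_cube)
  then obtain V where V: "V \<in> A (relabel \<tau> f) y" "\<And>i. i \<in> index f \<Longrightarrow> V (\<tau> i) \<le> w i"
    using relabel_transport_disjoint[OF f \<tau>(1), of y w, unfolded e] w by blast
  have "inj_on \<rho> (\<tau> ` index f)"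
    using \<sigma> \<rho> by (auto simp: inj_on_def)
  then have "\<exists>W \<in> A (relabel \<rho> (relabel \<tau> f)) z. \<forall>i\<in>index (relabel \<tau> f). W (\<rho> i) \<le> V i"
    using \<tau>(2) im z f V(1)
    by (intro relabel_transport_disjoint is_bfun_relabel) (auto simp: y_def)
  moreover have "relabel \<rho> (relabel \<tau> f) = relabel \<sigma> f"
    unfolding relabel_relabel by (rule relabel_cong) (simp add: \<rho>)
  ultimately obtain W where W: "W \<in> A (relabel \<sigma> f) z" "\<And>i. i \<in> index f \<Longrightarrow> W (\<rho> (\<tau> i)) \<le> V (\<tau> i)"
    by auto
  have "W (\<sigma> i) \<le> w i" if "i \<in> index f" for i
    using W(2)[OF that] V(2)[OF that] \<rho>[OF that] by simp
  then show ?thesis using W(1) by blast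
qed

text \<open>Transport along the inverse renaming, which leads from \<open>relabel \<sigma> f\<close>
  back to \<open>f\<close> itself.\<close>

lemma relabel_transport_back:
  assumes f: "is_bfun f" "index f \<noteq> {}" and \<sigma>: "inj_on \<sigma> (index f)"
    and z: "z \<in> cube (\<sigma> ` index f)" and W: "W \<in> A (relabel \<sigma> f) z"
  shows "\<exists>w \<in> A f (\<lambda>i \<in> index f. z (\<sigma> i)). \<forall>i\<in>index f. w i \<le> W (\<sigma> i)"
proof -
  define \<tau> where "\<tau> = inv_into (index f) \<sigma>"
  have \<tau>: "\<tau> (\<sigma> i) = i" if "i \<in> index f" for i using \<sigma> that by (simp add: \<tau>_def)
  have im: "\<tau> ` \<sigma> ` index f = index f" using \<tau> by force
  define y where "y = (\<lambda>i \<in> index f. z (\<sigma> i))"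
  have "(\<lambda>k \<in> \<sigma> ` index f. y (\<tau> k)) = z"
    using z \<tau> by (auto simp: y_def fun_eq_iff restrict_def cube_def PiE_iff extensional_def)
  then have "\<exists>w \<in> A (relabel \<tau> (relabel \<sigma> f)) y. \<forall>k\<in>index (relabel \<sigma> f). w (\<tau> k) \<le> W k"
    using f W im by (intro relabel_transport is_bfun_relabel)
      (auto simp: inj_on_def \<tau> y_def restrict_in_cube)
  moreover have "relabel \<tau> (relabel \<sigma> f) = f"
    unfolding relabel_relabel using f(1) \<tau> by (intro relabel_id) auto
  ultimately show ?thesis using \<tau> by (auto simp: y_def)
qed

end

section \<open>Weights on composed functions\<close>

lemma index_bfun_comp [simp]: "index (bfun_comp f g) = label_times (index f) (index g)"
  by (simp add: bfun_comp_def)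

lemma is_bfun_comp:
  assumes "is_bfun f" "is_bfun g"
  shows "is_bfun (bfun_comp f g)"
proof -
  have "label_times (index f) (index g) = (\<lambda>(i, j). Pr i j) ` (index f \<times> index g)"
    by (auto simp: label_times_def)
  then show ?thesis using assms by (simp add: is_bfun_def bfun_comp_def)
qed

text \<open>The copy of \<open>g\<close> below the middle node \<open>c i\<close> lives on the block
  of labels \<open>Pr i j\<close>. Indices of \<open>f\<close> might themselves be such labels, so
  the middle nodes get new names through \<open>c\<close>.\<close>

lemma bfun_comp_eq_two_level:
  assumes c: "inj_on c (index f)"
  shows "two_level (relabel c f) (\<lambda>k. relabel (Pr (inv_into (index f) c k)) g) = bfun_comp f g"
proof -
  let ?I = "index f" and ?J = "index g" and ?d = "inv_into (index f) c"
  have ix: "(\<Union>k\<in>c ` ?I. Pr (?d k) ` ?J) = label_times ?I ?J"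
    using c by (auto simp: label_times_def)
  have "eval f (\<lambda>i\<in>?I. (\<lambda>k\<in>c ` ?I. eval (relabel (Pr (?d k)) g) (restrict z (Pr (?d k) ` ?J))) (c i)) =
      eval f (\<lambda>i \<in> ?I. eval g (\<lambda>j \<in> ?J. z (Pr i j)))" for z
  proof (rule arg_cong[where f = "eval f"], rule restrict_ext)
    fix i assume i: "i \<in> ?I"
    show "(\<lambda>k\<in>c ` ?I. eval (relabel (Pr (?d k)) g) (restrict z (Pr (?d k) ` ?J))) (c i) =
        eval g (\<lambda>j \<in> ?J. z (Pr i j))"
      using i c by (simp add: eval_relabel_restrict)
  qed
  then show ?thesis
    unfolding two_level_def bfun_comp_def index_relabel ix
    by (simp add: relabel_def[of c] restrict_in_cube)
qed

context well_behaved_assemblage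
begin

text \<open>Weights of \<open>f\<close> are moved to fresh middle nodes and weights of
  \<open>g\<close> to the blocks, or back, around the tree statement. Transport gives domination
  rather than equality, so the first half bounds \<open>W\<close> coordinatewise from above and the
  second bounds its total from below.\<close>

lemma bfun_comp_weights:
  assumes f: "is_bfun f" "index f \<noteq> {}" and g: "is_bfun g" "index g \<noteq> {}"
    and z: "z \<in> cube (index (bfun_comp f g))"
  defines "y \<equiv> \<lambda>i. \<lambda>j \<in> index g. z (Pr i j)"
  defines "b \<equiv> \<lambda>i \<in> index f. eval g (y i)"
  shows bfun_comp_compose:
      "\<And>w u. w \<in> A f b \<Longrightarrow> (\<And>i. i \<in> index f \<Longrightarrow> u i \<in> A g (y i)) \<Longrightarrow>
         \<exists>W \<in> A (bfun_comp f g) z. \<forall>i\<in>index f. \<forall>j\<in>index g. W (Pr i j) \<le> w i * u i j"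
    and bfun_comp_decompose:
      "\<And>W. W \<in> A (bfun_comp f g) z \<Longrightarrow>
         \<exists>w \<in> A f b. \<exists>u. (\<forall>i\<in>index f. u i \<in> A g (y i)) \<and>
           (\<Sum>i\<in>index f. w i * total (index g) (u i)) \<le> total (index (bfun_comp f g)) W"
proof -
  let ?I = "index f" and ?J = "index g"
  have fin: "finite ?I" "finite (index (bfun_comp f g))"
    using f is_bfun_comp[OF f(1) g(1)] by (auto simp: is_bfun_def)
  obtain c :: "'a label \<Rightarrow> 'a label" where c: "inj_on c ?I" "c ` ?I \<inter> label_times ?I ?J = {}"
    using ex_fresh_inj[OF fin] by auto
  define d where "d = inv_into ?I c"
  have d: "d (c i) = i" if "i \<in> ?I" for i using that c by (simp add: d_def)
  define h where "h = relabel c f"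
  define G where "G = (\<lambda>k. relabel (Pr (d k)) g)"
  have tl: "two_level h G = bfun_comp f g"
    unfolding h_def G_def d_def by (rule bfun_comp_eq_two_level[OF c(1)])
  have ih: "index h = c ` ?I" by (simp add: h_def)
  have iG: "index (G (c i)) = Pr i ` ?J" if "i \<in> ?I" for i using d[OF that] by (simp add: G_def)
  have yz: "(\<lambda>j\<in>?J. restrict z (Pr i ` ?J) (Pr i j)) = y i" for i
    by (auto simp: restrict_def fun_eq_iff y_def)
  have eG: "eval (G (c i)) (restrict z (index (G (c i)))) = eval g (y i)" if "i \<in> ?I" for i
    unfolding iG[OF that] using d[OF that] by (simp add: G_def eval_relabel_restrict y_def)
  define b' where "b' = (\<lambda>k\<in>index h. eval (G k) (restrict z (index (G k))))"
  have bb: "(\<lambda>i\<in>?I. b' (c i)) = b"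
    unfolding b_def by (rule restrict_ext) (simp add: b'_def ih eG)
  have b': "b' \<in> cube (c ` ?I)" unfolding b'_def ih by (rule restrict_in_cube)
  have injP: "inj_on (Pr i) ?J" for i by (simp add: inj_on_def)
  have h: "is_bfun h" "index h \<noteq> {}" using f by (auto simp: h_def is_bfun_relabel)
  have G: "is_bfun (G k)" "index (G k) \<noteq> {}" for k using g by (auto simp: G_def is_bfun_relabel)
  have dG: "index (G k) \<inter> index (G k') = {}" if "k \<in> index h" "k' \<in> index h" "k \<noteq> k'" for k k'
    using that by (auto simp: ih iG)
  have dG': "index (G k) \<inter> index h = {}" if "k \<in> index h" for k
  proof -
    have "c i' \<noteq> Pr i j" if "i' \<in> ?I" "i \<in> ?I" "j \<in> ?J" for i i' j
      using c(2) that unfolding label_times_def by blast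
    then show ?thesis using that by (auto simp: ih iG)
  qed
  have z': "z \<in> cube (index (two_level h G))" using z by (simp add: tl)
  have compose: "\<exists>W \<in> A (bfun_comp f g) z. \<forall>k\<in>index h. \<forall>j\<in>index (G k). W j = w k * u k j"
    if "w \<in> A h b'" "\<And>k. k \<in> index h \<Longrightarrow> u k \<in> A (G k) (restrict z (index (G k)))" for w u
    using two_level_compose[OF wb asm h G dG dG' infinite_UNIV_label z', folded b'_def, unfolded tl]
      that by simp
  have decompose: "\<exists>w \<in> A h b'. \<exists>u. (\<forall>k\<in>index h. u k \<in> A (G k) (restrict z (index (G k)))) \<and>
      (\<Sum>k\<in>index h. w k * total (index (G k)) (u k)) \<le> total (index (bfun_comp f g)) W"
    if "W \<in> A (bfun_comp f g) z" for W
    using two_level_decompose[OF wb asm h G dG dG' infinite_UNIV_label z', folded b'_def, unfolded tl]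
      that by simp
  {
    fix w u assume w: "w \<in> A f b" and u: "\<And>i. i \<in> ?I \<Longrightarrow> u i \<in> A g (y i)"
    have "\<exists>w' \<in> A h b'. \<forall>i\<in>?I. w' (c i) \<le> w i"
      using relabel_transport[OF f c(1) b', of w] w unfolding bb h_def by simp
    then obtain w' where w': "w' \<in> A h b'" "\<And>i. i \<in> ?I \<Longrightarrow> w' (c i) \<le> w i"
      by auto
    have "\<exists>u' \<in> A (relabel (Pr i) g) (restrict z (Pr i ` ?J)). \<forall>j\<in>?J. u' (Pr i j) \<le> u i j"
      if "i \<in> ?I" for i
      using relabel_transport[OF g injP restrict_in_cube, of "u i" z i] u[OF that] unfolding yz by simp
    then obtain u' where u': "\<And>i. i \<in> ?I \<Longrightarrow> u' i \<in> A (relabel (Pr i) g) (restrict z (Pr i ` ?J))"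
      "\<And>i j. i \<in> ?I \<Longrightarrow> j \<in> ?J \<Longrightarrow> u' i (Pr i j) \<le> u i j"
      by metis
    have "u' (d k) \<in> A (G k) (restrict z (index (G k)))" if "k \<in> index h" for k
      using that u'(1) by (auto simp: ih iG d) (simp add: G_def d)
    from compose[OF w'(1) this] obtain W where W: "W \<in> A (bfun_comp f g) z"
      "\<And>k j. k \<in> index h \<Longrightarrow> j \<in> index (G k) \<Longrightarrow> W j = w' k * u' (d k) j" by blast
    have "W (Pr i j) \<le> w i * u i j" if ij: "i \<in> ?I" "j \<in> ?J" for i j
    proof -
      have "W (Pr i j) = w' (c i) * u' i (Pr i j)"
        using W(2)[of "c i" "Pr i j"] ij d by (simp add: ih iG)
      also have "\<dots> \<le> w i * u i j"
      proof (intro mult_mono w'(2) u'(2) ij)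
        have "w' (c i) \<ge> 0"
          using family_nonneg[OF h(1) _ w'(1)] b' ij by (simp add: ih)
        then show "w i \<ge> 0" using w'(2)[OF ij(1)] by simp
        show "u' i (Pr i j) \<ge> 0"
          using family_nonneg[OF is_bfun_relabel[OF g(1)] _ u'(1)[OF ij(1)], of "Pr i j"] ij
          by (simp add: restrict_in_cube)
      qed
      finally show ?thesis .
    qed
    then show "\<exists>W \<in> A (bfun_comp f g) z. \<forall>i\<in>?I. \<forall>j\<in>?J. W (Pr i j) \<le> w i * u i j"
      using W(1) by blast
  }
  {
    fix W assume "W \<in> A (bfun_comp f g) z"
    from decompose[OF this] obtain w' u' where w': "w' \<in> A h b'"
      and u': "\<And>k. k \<in> index h \<Longrightarrow> u' k \<in> A (G k) (restrict z (index (G k)))"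
      and le: "(\<Sum>k\<in>index h. w' k * total (index (G k)) (u' k)) \<le> total (index (bfun_comp f g)) W"
      by blast
    have "\<exists>w \<in> A f b. \<forall>i\<in>?I. w i \<le> w' (c i)"
      using relabel_transport_back[OF f c(1) b', of w'] w' unfolding bb h_def by simp
    then obtain w where w: "w \<in> A f b" "\<And>i. i \<in> ?I \<Longrightarrow> w i \<le> w' (c i)"
      by auto
    have u'i: "u' (c i) \<in> A (relabel (Pr i) g) (restrict z (Pr i ` ?J))" if "i \<in> ?I" for i
      using u'[of "c i"] that iG[OF that] d[OF that] by (simp add: ih G_def)
    have "\<exists>u \<in> A g (y i). \<forall>j\<in>?J. u j \<le> u' (c i) (Pr i j)" if "i \<in> ?I" for i
      using relabel_transport_back[OF g injP restrict_in_cube u'i[OF that]] unfolding yz .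
    then obtain u where u: "\<And>i. i \<in> ?I \<Longrightarrow> u i \<in> A g (y i)"
      "\<And>i j. i \<in> ?I \<Longrightarrow> j \<in> ?J \<Longrightarrow> u i j \<le> u' (c i) (Pr i j)"
      by metis
    \<comment> \<open>All factors are nonnegative, so passing to the dominated \<open>w\<close> and
      \<open>u\<close> cannot increase a summand.\<close>
    have "(\<Sum>i\<in>?I. w i * total ?J (u i)) \<le> (\<Sum>i\<in>?I. w' (c i) * total (Pr i ` ?J) (u' (c i)))"
    proof (rule sum_mono)
      fix i assume i: "i \<in> ?I"
      have "total (Pr i ` ?J) (u' (c i)) = (\<Sum>j\<in>?J. u' (c i) (Pr i j))"
        unfolding total_def by (simp add: sum.reindex[OF injP])
      then have "total ?J (u i) \<le> total (Pr i ` ?J) (u' (c i))"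
        using u(2)[OF i] by (simp add: total_def sum_mono)
      moreover have "total ?J (u i) \<ge> 0"
        unfolding total_def using family_nonneg[OF g(1) _ u(1)[OF i]]
        by (intro sum_nonneg) (simp add: y_def restrict_in_cube)
      moreover have "w i \<ge> 0"
        using family_nonneg[OF f(1) _ w(1) i] by (simp add: b_def restrict_in_cube)
      ultimately show "w i * total ?J (u i) \<le> w' (c i) * total (Pr i ` ?J) (u' (c i))"
        using w(2)[OF i] by (intro mult_mono) auto
    qed
    also have "\<dots> = (\<Sum>k\<in>index h. w' k * total (index (G k)) (u' k))"
      unfolding ih by (simp add: sum.reindex[OF c(1)] iG)
    also note le
    finally show "\<exists>w \<in> A f b. \<exists>u. (\<forall>i\<in>?I. u i \<in> A g (y i)) \<and>
           (\<Sum>i\<in>?I. w i * total ?J (u i)) \<le> total (index (bfun_comp f g)) W"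
      using w(1) u(1) by (intro bexI[of _ w] exI[of _ u]) auto
  }
qed

end

section \<open>Growth of the iterated composition\<close>

lemma finite_cube: "finite I \<Longrightarrow> finite (cube I)"
  by (simp add: cube_def finite_PiE)

lemma nonconstant_index_nonempty: "nonconstant f \<Longrightarrow> index f \<noteq> {}"
  by (auto simp: nonconstant_def cube_def)

lemma is_bfun_pow: "is_bfun f \<Longrightarrow> is_bfun (bfun_pow f (Suc n))"
  by (induction n) (auto intro: is_bfun_comp)

lemma index_pow_nonempty: "index f \<noteq> {} \<Longrightarrow> index (bfun_pow f (Suc n)) \<noteq> {}"
  by (induction n) (auto simp: label_times_def)

lemma eval_bfun_comp:
  "z \<in> cube (index (bfun_comp f g)) \<Longrightarrow>
    eval (bfun_comp f g) z = eval f (\<lambda>i \<in> index f. eval g (\<lambda>j \<in> index g. z (Pr i j)))"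
  by (simp add: bfun_comp_def)

lemma total_label_times:
  "total (label_times I J) W = (\<Sum>i\<in>I. \<Sum>j\<in>J. W (Pr i j))"
proof -
  have eq: "label_times I J = (\<lambda>(i, j). Pr i j) ` (I \<times> J)"
    by (auto simp: label_times_def)
  have "inj_on (\<lambda>(i, j). Pr i j) (I \<times> J)" by (auto simp: inj_on_def)
  then show ?thesis
    unfolding total_def eq sum.cartesian_product by (subst sum.reindex) (auto intro!: sum.cong)
qed

section \<open>Estimates for the induced measure\<close>

context well_behaved_assemblage
begin

lemma bdd_below_total:
  assumes "is_bfun f" "x \<in> cube (index f)"
  shows "bdd_below (total (index f) ` A f x)"
  using family_nonneg[OF assms] by (auto simp: total_def intro!: bdd_belowI[of _ 0] sum_nonneg)

lemma local_measure_le: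
  assumes "is_bfun f" "x \<in> cube (index f)" "W \<in> A f x" "total (index f) W \<le> c"
  shows "local_measure A f x \<le> c"
  unfolding local_measure_def
  using assms(3,4) by (intro cInf_lower2[OF _ _ bdd_below_total[OF assms(1,2)]]) auto

lemma local_measure_ge:
  assumes "is_bfun f" "x \<in> cube (index f)" "\<And>W. W \<in> A f x \<Longrightarrow> c \<le> total (index f) W"
  shows "c \<le> local_measure A f x"
  unfolding local_measure_def
  using family_nonempty[OF assms(1,2)] assms(3) by (intro cInf_greatest) auto

text \<open>Nonconstancy supplies inputs of either value, so both maxima are taken over nonempty
  finite sets.\<close>

lemma measure_le:
  assumes f: "is_bfun f" "nonconstant f" and le: "\<And>x. x \<in> cube (index f) \<Longrightarrow> local_measure A f x \<le> c"
  shows "measure_of_family A f \<le> c"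
proof -
  have "finite (cube (index f))" using f by (simp add: is_bfun_def finite_cube)
  moreover have "{x \<in> cube (index f). eval f x = b} \<noteq> {}" for b
    using f(2) unfolding nonconstant_def by (cases b) auto
  ultimately have "bit_measure A b f \<le> c" for b
    unfolding bit_measure_def using le by (intro Max.boundedI) auto
  then show ?thesis by (simp add: measure_of_family_def)
qed

lemma measure_ge:
  assumes f: "is_bfun f" and x: "x \<in> cube (index f)" "c \<le> local_measure A f x"
  shows "c \<le> measure_of_family A f"
proof -
  have "finite (cube (index f))" using f by (simp add: is_bfun_def finite_cube)
  then have "local_measure A f x \<le> bit_measure A (eval f x) f"
    unfolding bit_measure_def using x by (intro Max_ge) auto
  also have "\<dots> \<le> measure_of_family A f"
    by (cases "eval f x") (auto simp: measure_of_family_def)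
  finally show ?thesis using x(2) by simp
qed

lemma measure_nonneg:
  assumes "is_bfun f"
  shows "measure_of_family A f \<ge> 0"
proof (rule measure_ge[OF assms restrict_in_cube])
  show "0 \<le> local_measure A f (restrict undefined (index f))"
    using family_nonneg[OF assms restrict_in_cube]
    by (intro local_measure_ge[OF assms restrict_in_cube]) (auto simp: total_def intro!: sum_nonneg)
qed

section \<open>Weight bounds on powers from invariant vectors\<close>

text \<open>Induction on the layers, adding the outermost \<open>f\<close>: each block contributes
  its own \<open>v (b i)\<close>, and subinvariance folds these into \<open>v\<close> of the output
  at the cost of one factor \<open>\<kappa>\<close>. The lower bound \<open>m\<close> of
  \<open>v\<close> enters at the leaves.\<close>

lemma pow_weight_upper:
  assumes f: "is_bfun f" "index f \<noteq> {}" and \<kappa>: "\<kappa> \<ge> 0" and m: "\<And>b. m \<le> v b" "m \<ge> 0"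
    and sub: "\<And>x. x \<in> cube (index f) \<Longrightarrow>
      \<exists>w \<in> A f x. (\<Sum>i\<in>index f. w i * v (x i)) \<le> \<kappa> * v (eval f x)"
    and z: "z \<in> cube (index (bfun_pow f (Suc n)))"
  shows "\<exists>W \<in> A (bfun_pow f (Suc n)) z.
    total (index (bfun_pow f (Suc n))) W * m \<le> \<kappa> ^ Suc n * v (eval (bfun_pow f (Suc n)) z)"
  using z
proof (induction n arbitrary: z)
  case 0
  then have z: "z \<in> cube (index f)" by simp
  obtain w where w: "w \<in> A f z" "(\<Sum>i\<in>index f. w i * v (z i)) \<le> \<kappa> * v (eval f z)"
    using sub[OF z] by blast
  have "total (index f) w * m \<le> (\<Sum>i\<in>index f. w i * v (z i))"
    unfolding total_def sum_distrib_right
    using m(1) family_nonneg[OF f(1) z w(1)] by (intro sum_mono mult_left_mono) auto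
  then show ?case using w by (intro bexI[of _ w]) auto
next
  case (Suc n)
  define g where "g = bfun_pow f (Suc n)"
  have pow: "bfun_pow f (Suc (Suc n)) = bfun_comp f g" by (simp add: g_def)
  have g: "is_bfun g" "index g \<noteq> {}"
    unfolding g_def using is_bfun_pow[OF f(1)] index_pow_nonempty[OF f(2)] by auto
  have z: "z \<in> cube (index (bfun_comp f g))" using Suc.prems unfolding pow .
  define y where "y = (\<lambda>i. \<lambda>j \<in> index g. z (Pr i j))"
  define b where "b = (\<lambda>i \<in> index f. eval g (y i))"
  have y: "y i \<in> cube (index g)" for i by (simp add: y_def restrict_in_cube)
  have b: "b \<in> cube (index f)" by (simp add: b_def restrict_in_cube)
  have ev: "eval (bfun_comp f g) z = eval f b"
    unfolding eval_bfun_comp[OF z] b_def y_def ..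
  obtain w where w: "w \<in> A f b" "(\<Sum>i\<in>index f. w i * v (b i)) \<le> \<kappa> * v (eval f b)"
    using sub[OF b] by blast
  have w0: "w i \<ge> 0" if "i \<in> index f" for i by (rule family_nonneg[OF f(1) b w(1) that])
  have "\<exists>u \<in> A g (y i). total (index g) u * m \<le> \<kappa> ^ Suc n * v (eval g (y i))" for i
    using Suc.IH[of "y i"] y unfolding g_def by blast
  then obtain u where u: "\<And>i. u i \<in> A g (y i)"
    "\<And>i. total (index g) (u i) * m \<le> \<kappa> ^ Suc n * v (eval g (y i))" by metis
  obtain W where W: "W \<in> A (bfun_comp f g) z"
    "\<And>i j. i \<in> index f \<Longrightarrow> j \<in> index g \<Longrightarrow> W (Pr i j) \<le> w i * u i j"
    using bfun_comp_compose[OF f g z, of w u] w(1) u(1) unfolding b_def y_def by blast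
  have "total (index (bfun_comp f g)) W \<le> (\<Sum>i\<in>index f. w i * total (index g) (u i))"
    unfolding index_bfun_comp total_label_times unfolding total_def sum_distrib_left
    by (intro sum_mono W(2))
  then have "total (index (bfun_comp f g)) W * m \<le> (\<Sum>i\<in>index f. w i * total (index g) (u i)) * m"
    using m(2) by (rule mult_right_mono)
  also have "\<dots> = (\<Sum>i\<in>index f. w i * (total (index g) (u i) * m))"
    by (simp add: sum_distrib_right mult.assoc)
  also have "\<dots> \<le> (\<Sum>i\<in>index f. w i * (\<kappa> ^ Suc n * v (b i)))"
    using u(2) w0 by (intro sum_mono mult_left_mono) (auto simp: b_def)
  also have "\<dots> = \<kappa> ^ Suc n * (\<Sum>i\<in>index f. w i * v (b i))"
    unfolding sum_distrib_left by (intro sum.cong) (auto simp: mult_ac)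
  also have "\<dots> \<le> \<kappa> ^ Suc n * (\<kappa> * v (eval f b))"
    using w(2) \<kappa> by (intro mult_left_mono) auto
  finally have "total (index (bfun_comp f g)) W * m \<le> \<kappa> ^ Suc (Suc n) * v (eval (bfun_comp f g) z)"
    by (simp add: ev mult_ac)
  then show ?case unfolding pow using W(1) by blast
qed

text \<open>The dual induction yields, for each output bit, one input on which all weights are
  heavy. A weight on the composition splits, without gain in total, into an outer weight and block
  weights; \<open>super\<close> handles the former and the induction hypothesis the latter.\<close>

lemma pow_weight_lower:
  assumes f: "is_bfun f" "index f \<noteq> {}" and \<kappa>: "\<kappa> \<ge> 0" and M: "\<And>b. v b \<le> M" "M \<ge> 0"
    and \<alpha>: "compatible_selector f \<alpha>"
    and super: "\<And>s w. w \<in> A f (\<alpha> s) \<Longrightarrow> \<kappa> * v s \<le> (\<Sum>i\<in>index f. w i * v (\<alpha> s i))"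
  shows "\<exists>z \<in> cube (index (bfun_pow f (Suc n))). eval (bfun_pow f (Suc n)) z = s \<and>
    (\<forall>W \<in> A (bfun_pow f (Suc n)) z. \<kappa> ^ Suc n * v s \<le> total (index (bfun_pow f (Suc n))) W * M)"
proof (induction n arbitrary: s)
  case 0
  have a: "\<alpha> s \<in> cube (index f)" "eval f (\<alpha> s) = s" using \<alpha> by (auto simp: compatible_selector_def)
  have "\<kappa> * v s \<le> total (index f) w * M" if w: "w \<in> A f (\<alpha> s)" for w
  proof -
    have "(\<Sum>i\<in>index f. w i * v (\<alpha> s i)) \<le> total (index f) w * M"
      unfolding total_def sum_distrib_right
      using M(1) family_nonneg[OF f(1) a(1) w] by (intro sum_mono mult_left_mono) auto
    then show ?thesis using super[OF w] by simp
  qed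
  then show ?case using a by (intro bexI[of _ "\<alpha> s"]) auto
next
  case (Suc n)
  define g where "g = bfun_pow f (Suc n)"
  have pow: "bfun_pow f (Suc (Suc n)) = bfun_comp f g" by (simp add: g_def)
  have g: "is_bfun g" "index g \<noteq> {}"
    unfolding g_def using is_bfun_pow[OF f(1)] index_pow_nonempty[OF f(2)] by auto
  obtain \<zeta> where \<zeta>: "\<And>t. \<zeta> t \<in> cube (index g)" "\<And>t. eval g (\<zeta> t) = t"
    "\<And>t W. W \<in> A g (\<zeta> t) \<Longrightarrow> \<kappa> ^ Suc n * v t \<le> total (index g) W * M"
    using Suc.IH unfolding g_def[symmetric] by metis
  have a: "\<alpha> s \<in> cube (index f)" "eval f (\<alpha> s) = s" using \<alpha> by (auto simp: compatible_selector_def)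
  \<comment> \<open>Block \<open>i\<close> receives the hard input for the bit
    \<open>\<alpha> s i\<close>. The \<open>Atom\<close> case is a default outside the product
    labels.\<close>
  define z where "z = (\<lambda>l \<in> label_times (index f) (index g).
    case l of Pr i j \<Rightarrow> \<zeta> (\<alpha> s i) j | Atom _ \<Rightarrow> undefined)"
  have z: "z \<in> cube (index (bfun_comp f g))" by (simp add: z_def restrict_in_cube)
  have y: "(\<lambda>j \<in> index g. z (Pr i j)) = \<zeta> (\<alpha> s i)" if "i \<in> index f" for i
  proof -
    have "(\<lambda>j \<in> index g. z (Pr i j)) = restrict (\<zeta> (\<alpha> s i)) (index g)"
      using that by (intro restrict_ext) (simp add: z_def label_times_def)
    then show ?thesis using \<zeta>(1)[of "\<alpha> s i"] by (simp add: cube_def)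
  qed
  have b: "(\<lambda>i \<in> index f. eval g (\<lambda>j \<in> index g. z (Pr i j))) = \<alpha> s"
  proof -
    have "(\<lambda>i \<in> index f. eval g (\<lambda>j \<in> index g. z (Pr i j))) = restrict (\<alpha> s) (index f)"
      by (intro restrict_ext) (simp add: y \<zeta>(2))
    then show ?thesis using a(1) by (simp add: cube_def)
  qed
  have "eval (bfun_comp f g) z = s" unfolding eval_bfun_comp[OF z] b by (rule a(2))
  moreover have "\<kappa> ^ Suc (Suc n) * v s \<le> total (index (bfun_comp f g)) W * M"
    if W: "W \<in> A (bfun_comp f g) z" for W
  proof -
    obtain w u where w: "w \<in> A f (\<alpha> s)"
      and u: "\<And>i. i \<in> index f \<Longrightarrow> u i \<in> A g (\<lambda>j \<in> index g. z (Pr i j))"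
      and le: "(\<Sum>i\<in>index f. w i * total (index g) (u i)) \<le> total (index (bfun_comp f g)) W"
      using bfun_comp_decompose[OF f g z W] unfolding b by blast
    have w0: "w i \<ge> 0" if "i \<in> index f" for i by (rule family_nonneg[OF f(1) a(1) w that])
    have ui: "\<kappa> ^ Suc n * v (\<alpha> s i) \<le> total (index g) (u i) * M" if "i \<in> index f" for i
      using u[OF that] unfolding y[OF that] by (rule \<zeta>(3))
    have "\<kappa> ^ Suc (Suc n) * v s = \<kappa> ^ Suc n * (\<kappa> * v s)" by (simp add: mult_ac)
    also have "\<dots> \<le> \<kappa> ^ Suc n * (\<Sum>i\<in>index f. w i * v (\<alpha> s i))"
      using super[OF w] \<kappa> by (intro mult_left_mono) auto
    also have "\<dots> = (\<Sum>i\<in>index f. w i * (\<kappa> ^ Suc n * v (\<alpha> s i)))"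
      unfolding sum_distrib_left by (intro sum.cong) (auto simp: mult_ac)
    also have "\<dots> \<le> (\<Sum>i\<in>index f. w i * (total (index g) (u i) * M))"
      using ui w0 by (intro sum_mono mult_left_mono) auto
    also have "\<dots> = (\<Sum>i\<in>index f. w i * total (index g) (u i)) * M"
      by (simp add: sum_distrib_right mult.assoc)
    also have "\<dots> \<le> total (index (bfun_comp f g)) W * M"
      using le M(2) by (rule mult_right_mono)
    finally show ?thesis .
  qed
  ultimately show ?case unfolding pow using z by blast
qed

section \<open>Existence of sub- and superinvariant vectors\<close>

text \<open>An input of value 0 and one of value 1 form a selector, whose value below
  \<open>\<kappa>\<close> yields a \<open>t\<close> for this pair. The row conditions
  \<open>P\<close> and \<open>Q\<close> are monotone in opposite directions, so the minimax
  principle gives one \<open>t\<close> for all inputs.\<close>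

lemma ex_subinvariant_vector:
  assumes f: "is_bfun f" "nonconstant f"
    and less: "\<And>\<alpha>. compatible_selector f \<alpha> \<Longrightarrow> selector_value A f \<alpha> < \<kappa>"
  obtains t where "t > 0" "\<And>x. x \<in> cube (index f) \<Longrightarrow>
    \<exists>w \<in> A f x. (\<Sum>i\<in>index f. w i * (if x i then t else 1)) \<le> \<kappa> * (if eval f x then t else 1)"
proof -
  have fin: "finite (index f)" "finite (cube (index f))"
    using f by (auto simp: is_bfun_def finite_cube)
  define X where "X = {x \<in> cube (index f). \<not> eval f x}"
  define Y where "Y = {x \<in> cube (index f). eval f x}"
  define P where "P = (\<lambda>x t. \<exists>w \<in> A f x. (\<Sum>i\<in>index f. w i * (if x i then t else 1)) \<le> \<kappa>)"
  define Q where "Q = (\<lambda>x t. \<exists>w \<in> A f x. (\<Sum>i\<in>index f. w i * (if x i then t else 1)) \<le> \<kappa> * t)"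
  have "\<exists>t>0. (\<forall>x\<in>X. P x t) \<and> (\<forall>y\<in>Y. Q y t)"
  proof (rule finite_minimax_common_point)
    show "finite X" "finite Y" using fin by (auto simp: X_def Y_def)
    show "X \<noteq> {}" "Y \<noteq> {}" using f(2) by (auto simp: nonconstant_def X_def Y_def)
  next
    fix x y assume xy: "x \<in> X" "y \<in> Y"
    define \<alpha> where "\<alpha> = (\<lambda>b. if b then y else x)"
    have \<alpha>: "compatible_selector f \<alpha>"
      using xy by (auto simp: compatible_selector_def \<alpha>_def X_def Y_def)
    have a: "\<alpha> b \<in> cube (index f)" for b using \<alpha> by (simp add: compatible_selector_def)
    have "\<forall>b. \<exists>w. w \<in> A f (\<alpha> b)" using family_nonempty[OF f(1) a] by blast
    then have "\<exists>w. \<forall>b. w b \<in> A f (\<alpha> b)" by (rule choice)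
    then have "{spectral_radius (profile_matrix (index f) \<alpha> w) | w. \<forall>b. w b \<in> A f (\<alpha> b)} \<noteq> {}" by blast
    from cInf_lessD[OF this less[OF \<alpha>, unfolded selector_value_def]]
    obtain w where w: "\<And>b. w b \<in> A f (\<alpha> b)" "spectral_radius (profile_matrix (index f) \<alpha> w) < \<kappa>" by auto
    have "w s \<in> weights (index f)" for s by (rule family_weights[OF f(1) a w(1)])
    from spectral_radius_profile_less_imp[OF fin(1) this w(2)]
    obtain t where "t > 0" "(\<Sum>i\<in>index f. w False i * (if \<alpha> False i then t else 1)) \<le> \<kappa>"
      "(\<Sum>i\<in>index f. w True i * (if \<alpha> True i then t else 1)) \<le> \<kappa> * t" .
    moreover have "w False \<in> A f x" "w True \<in> A f y" using w(1)[of False] w(1)[of True] by (auto simp: \<alpha>_def)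
    ultimately show "\<exists>t>0. P x t \<and> Q y t"
      unfolding P_def Q_def by (intro exI[of _ t]) (auto simp: \<alpha>_def)
  next
    fix x and s t :: real assume x: "x \<in> X" and st: "0 < s" "s \<le> t" and "P x t"
    then obtain w where w: "w \<in> A f x" "(\<Sum>i\<in>index f. w i * (if x i then t else 1)) \<le> \<kappa>"
      by (auto simp: P_def)
    have "(\<Sum>i\<in>index f. w i * (if x i then s else 1)) \<le> (\<Sum>i\<in>index f. w i * (if x i then t else 1))"
      using st family_nonneg[OF f(1) _ w(1)] x by (intro sum_mono mult_left_mono) (auto simp: X_def)
    then show "P x s" using w unfolding P_def by (intro bexI[of _ w]) auto
  next
    fix y and s t :: real assume y: "y \<in> Y" and st: "0 < s" "s \<le> t" and "Q y s"
    then obtain w where w: "w \<in> A f y" "(\<Sum>i\<in>index f. w i * (if y i then s else 1)) \<le> \<kappa> * s"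
      by (auto simp: Q_def)
    \<comment> \<open>Since \<open>t / s\<close> is at least 1, the vector \<open>(1, t)\<close> is
      dominated by \<open>t / s\<close> times \<open>(1, s)\<close>, and the row inequality
      scales.\<close>
    have "(\<Sum>i\<in>index f. w i * (if y i then t else 1)) \<le> (\<Sum>i\<in>index f. w i * (t / s * (if y i then s else 1)))"
      using st family_nonneg[OF f(1) _ w(1)] y by (intro sum_mono mult_left_mono) (auto simp: Y_def)
    also have "\<dots> = t / s * (\<Sum>i\<in>index f. w i * (if y i then s else 1))"
      unfolding sum_distrib_left by (intro sum.cong) (auto simp: mult_ac)
    also have "\<dots> \<le> t / s * (\<kappa> * s)" using w(2) st by (intro mult_left_mono) auto
    also have "\<dots> = \<kappa> * t" using st by simp
    finally show "Q y t" using w(1) unfolding Q_def by blast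
  qed
  then obtain t where t: "t > 0" "\<And>x. x \<in> X \<Longrightarrow> P x t" "\<And>y. y \<in> Y \<Longrightarrow> Q y t" by blast
  have "\<exists>w \<in> A f x. (\<Sum>i\<in>index f. w i * (if x i then t else 1)) \<le> \<kappa> * (if eval f x then t else 1)"
    if "x \<in> cube (index f)" for x
    using t(2)[of x] t(3)[of x] that unfolding P_def Q_def X_def Y_def by (cases "eval f x") auto
  then show thesis using that t(1) by blast
qed

text \<open>The vector is \<open>(1, 0)\<close>, \<open>(0, 1)\<close> or \<open>(1, t)\<close>. If
  neither boundary vector works, \<open>U\<close> contains all small and \<open>V\<close> some
  positive \<open>t\<close>; being open and disjoint there, they leave a gap in the half
  line.\<close>

lemma ex_superinvariant_vector:
  assumes f: "is_bfun f" and \<alpha>: "compatible_selector f \<alpha>" and \<kappa>: "\<kappa> > 0" "\<kappa> < selector_value A f \<alpha>"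
  obtains v :: "bool \<Rightarrow> real" and s where "\<And>b. v b \<ge> 0" "v s > 0"
    "\<And>b w. w \<in> A f (\<alpha> b) \<Longrightarrow> \<kappa> * v b \<le> (\<Sum>i\<in>index f. w i * v (\<alpha> b i))"
proof -
  have fin: "finite (index f)" using f by (auto simp: is_bfun_def)
  have a: "\<alpha> b \<in> cube (index f)" for b using \<alpha> by (simp add: compatible_selector_def)
  have nn: "w i \<ge> 0" if "w \<in> A f (\<alpha> b)" "i \<in> index f" for w b i
    by (rule family_nonneg[OF f a that])
  have sr: "\<kappa> < spectral_radius (profile_matrix (index f) \<alpha> w)" if "\<And>b. w b \<in> A f (\<alpha> b)" for w
  proof -
    have "selector_value A f \<alpha> \<le> spectral_radius (profile_matrix (index f) \<alpha> w)"
      unfolding selector_value_def using that spectral_radius_profile_nonneg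
      by (intro cInf_lower bdd_belowI[of _ 0]) auto
    then show ?thesis using \<kappa> by simp
  qed
  define S where "S = (\<lambda>b w t. \<Sum>i\<in>index f. w i * (if \<alpha> b i then t else 1 :: real))"
  \<comment> \<open>\<open>U\<close> and \<open>V\<close> collect the \<open>t\<close> at which some
    weight violates row 0 or row 1, respectively.\<close>
  define U where "U = (\<Union>w \<in> A f (\<alpha> False). {t. S False w t < \<kappa>})"
  define V where "V = (\<Union>w \<in> A f (\<alpha> True). {t. S True w t < \<kappa> * t})"
  have cont: "continuous_on UNIV (S b w)" for b w
  proof -
    have "continuous_on UNIV (\<lambda>t. if \<alpha> b i then t else 1 :: real)" for i by (cases "\<alpha> b i") auto
    then show ?thesis unfolding S_def by (intro continuous_intros)
  qed
  have oU: "open U" unfolding U_def using cont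
    by (intro open_UN ballI open_Collect_less) (auto intro: continuous_intros)
  have oV: "open V" unfolding V_def using cont
    by (intro open_UN ballI open_Collect_less) (auto intro!: continuous_intros)
  \<comment> \<open>At a common positive \<open>t\<close> the two violating weights together would
    give a spectral radius of at most \<open>\<kappa>\<close>.\<close>
  have disj: "U \<inter> V \<inter> {0<..} = {}"
  proof (rule ccontr)
    assume "U \<inter> V \<inter> {0<..} \<noteq> {}"
    then obtain t w0 w1 where t: "t > 0" "w0 \<in> A f (\<alpha> False)" "S False w0 t < \<kappa>"
      "w1 \<in> A f (\<alpha> True)" "S True w1 t < \<kappa> * t" by (auto simp: U_def V_def)
    define w where "w = (\<lambda>b. if b then w1 else w0)"
    have w: "w b \<in> A f (\<alpha> b)" for b using t by (simp add: w_def)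
    have "spectral_radius (profile_matrix (index f) \<alpha> w) \<le> \<kappa>"
    proof (rule spectral_radius_profile_le[OF fin, where v = "\<lambda>b. if b then t else 1"])
      show "w s \<in> weights (index f)" for s by (rule family_weights[OF f a w])
      show "(\<Sum>i\<in>index f. w s i * (if \<alpha> s i then t else 1)) \<le> \<kappa> * (if s then t else 1)" for s
        using t by (cases s) (auto simp: S_def w_def)
    qed (use t in auto)
    then show False using sr[OF w] by simp
  qed
  \<comment> \<open>The alternative \<open>inf\<close> compares the coefficients of \<open>t\<close>
    in row 1, as for \<open>t\<close> tending to infinity.\<close>
  consider (zero) "0 \<notin> U" | (inf) "\<And>w. w \<in> A f (\<alpha> True) \<Longrightarrow> \<kappa> \<le> (\<Sum>i\<in>index f. w i * of_bool (\<alpha> True i))"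
    | (mid) t where "t > 0" "t \<notin> U" "t \<notin> V"
  proof -
    have False if 0: "0 \<in> U" and w: "w \<in> A f (\<alpha> True)" "\<not> \<kappa> \<le> (\<Sum>i\<in>index f. w i * of_bool (\<alpha> True i))"
      and UV: "{0<..} \<subseteq> U \<union> V" for w
    proof -
      obtain e where "e > 0" "\<And>t. dist t 0 < e \<Longrightarrow> t \<in> U" using oU 0 unfolding open_dist by blast
      then have "e / 2 \<in> U \<inter> {0<..}" by auto
      moreover have "V \<inter> {0<..} \<noteq> {}"
      proof -
        define d where "d = (\<Sum>i\<in>index f. w i * of_bool (\<alpha> True i))"
        define c where "c = (\<Sum>i\<in>index f. w i * of_bool (\<not> \<alpha> True i))"
        have S: "S True w t = c + d * t" for t
          unfolding S_def c_def d_def sum_distrib_right sum.distrib[symmetric]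
          by (intro sum.cong) auto
        have "c \<ge> 0" unfolding c_def using nn[OF w(1)] by (intro sum_nonneg) auto
        have d: "d < \<kappa>" using w(2) by (simp add: d_def)
        \<comment> \<open>Row 1 is affine in \<open>t\<close> with slope \<open>d\<close> below
          \<open>\<kappa>\<close>, so it fails for large \<open>t\<close>; the summand 1 makes the
          failure strict.\<close>
        define t where "t = c / (\<kappa> - d) + 1"
        have "t > 0" using \<open>c \<ge> 0\<close> d by (simp add: t_def add_nonneg_pos)
        moreover have "(\<kappa> - d) * t = c + (\<kappa> - d)" using d by (simp add: t_def distrib_left)
        then have "S True w t < \<kappa> * t" using d unfolding S by (simp add: algebra_simps)
        ultimately show ?thesis using w(1) by (auto simp: V_def)
      qed
      ultimately show False
        using connectedD[OF _ oU oV disj UV] by (auto simp: connected_Ioi)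
    qed
    then show thesis using that by (metis UnCI greaterThan_iff subsetI Un_iff)
  qed
  then show thesis
  proof cases
    case zero
    show thesis
    proof (rule that[of "\<lambda>b. of_bool (\<not> b)" False])
      fix b w assume w: "w \<in> A f (\<alpha> b)"
      show "\<kappa> * of_bool (\<not> b) \<le> (\<Sum>i\<in>index f. w i * of_bool (\<not> \<alpha> b i))"
      proof (cases b)
        case True
        then show ?thesis using nn[OF w] by (auto intro: sum_nonneg)
      next
        case False
        then have "\<kappa> \<le> S b w 0" using zero w by (auto simp: U_def not_less)
        also have "\<dots> = (\<Sum>i\<in>index f. w i * of_bool (\<not> \<alpha> b i))"
          unfolding S_def by (intro sum.cong) auto
        finally show ?thesis using False by simp
      qed
    qed auto
  next
    case inf
    show thesis
    proof (rule that[of of_bool True])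
      fix b w assume w: "w \<in> A f (\<alpha> b)"
      show "\<kappa> * of_bool b \<le> (\<Sum>i\<in>index f. w i * of_bool (\<alpha> b i))"
        using inf w nn[OF w] by (cases b) (auto intro: sum_nonneg)
    qed auto
  next
    case mid
    show thesis
    proof (rule that[of "\<lambda>b. if b then t else 1" True])
      fix b w assume w: "w \<in> A f (\<alpha> b)"
      show "\<kappa> * (if b then t else 1) \<le> (\<Sum>i\<in>index f. w i * (if \<alpha> b i then t else 1))"
        using mid w unfolding U_def V_def S_def by (cases b) (auto simp: not_less)
    qed (use mid in auto)
  qed
qed

section \<open>Selectors and geometric bounds for the measure\<close>

lemma ex_compatible_selector:
  assumes "nonconstant f"
  shows "\<exists>\<alpha>. compatible_selector f \<alpha>"
proof -
  have "\<forall>b. \<exists>x. x \<in> cube (index f) \<and> eval f x = b"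
    using assms unfolding nonconstant_def by (metis (full_types))
  then have "\<exists>\<alpha>. \<forall>b. \<alpha> b \<in> cube (index f) \<and> eval f (\<alpha> b) = b" by (rule choice)
  then show ?thesis unfolding compatible_selector_def .
qed

lemma finite_compatible_selectors:
  assumes "is_bfun f"
  shows "finite {\<alpha>. compatible_selector f \<alpha>}"
proof (rule finite_subset)
  show "finite ((\<lambda>(x, y) b. if b then y else x) ` (cube (index f) \<times> cube (index f)))"
    using assms by (simp add: is_bfun_def finite_cube)
  show "{\<alpha>. compatible_selector f \<alpha>} \<subseteq> (\<lambda>(x, y) b. if b then y else x) ` (cube (index f) \<times> cube (index f))"
  proof
    fix \<alpha> assume "\<alpha> \<in> {\<alpha>. compatible_selector f \<alpha>}"
    then show "\<alpha> \<in> (\<lambda>(x, y) b. if b then y else x) ` (cube (index f) \<times> cube (index f))"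
      by (intro image_eqI[of _ _ "(\<alpha> False, \<alpha> True)"]) (auto simp: compatible_selector_def fun_eq_iff)
  qed
qed

lemma selector_value_nonneg:
  assumes "is_bfun f" "compatible_selector f \<alpha>"
  shows "selector_value A f \<alpha> \<ge> 0"
proof -
  have "\<forall>b. \<exists>w. w \<in> A f (\<alpha> b)"
    using family_nonempty[OF assms(1)] assms(2) by (auto simp: compatible_selector_def)
  then have "\<exists>w. \<forall>b. w b \<in> A f (\<alpha> b)" by (rule choice)
  then show ?thesis
    unfolding selector_value_def using spectral_radius_profile_nonneg by (intro cInf_greatest) auto
qed

text \<open>The induction of \<open>pow_weight_lower\<close> already builds inputs of either value;
  with \<open>\<kappa> = 0\<close> and \<open>v = 0\<close> its weight bounds are trivial.\<close>

lemma nonconstant_pow: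
  fixes f :: "'a label bfun"
  assumes f: "is_bfun f" "nonconstant f"
  shows "nonconstant (bfun_pow f (Suc n))"
proof -
  obtain \<alpha> where "compatible_selector f \<alpha>" using ex_compatible_selector[OF f(2)] by blast
  then have "\<exists>z \<in> cube (index (bfun_pow f (Suc n))). eval (bfun_pow f (Suc n)) z = s" for s
    using pow_weight_lower[OF f(1) nonconstant_index_nonempty[OF f(2)], of 0 "\<lambda>_. 0" 0 \<alpha> n s] by auto
  from this[of False] this[of True] show ?thesis unfolding nonconstant_def by metis
qed

text \<open>All selectors have value below \<open>\<kappa>\<close>, so some \<open>(1, t)\<close> is
  subinvariant for every input. The constant is the ratio of its largest to its smallest
  coordinate.\<close>

lemma measure_pow_upper:
  assumes f: "is_bfun f" "nonconstant f" and \<kappa>: "characteristic_value A f < \<kappa>"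
  obtains C where "C > 0" "\<And>n. measure_of_family A (bfun_pow f (Suc n)) \<le> C * \<kappa> ^ Suc n"
proof -
  note I = nonconstant_index_nonempty[OF f(2)]
  have le: "selector_value A f \<alpha> \<le> characteristic_value A f" if "compatible_selector f \<alpha>" for \<alpha>
    unfolding characteristic_value_def using that finite_compatible_selectors[OF f(1)]
    by (intro Max_ge) auto
  then have less: "selector_value A f \<alpha> < \<kappa>" if "compatible_selector f \<alpha>" for \<alpha>
    using that \<kappa> by fastforce
  have \<kappa>0: "\<kappa> \<ge> 0"
    using ex_compatible_selector[OF f(2)] selector_value_nonneg[OF f(1)] less by fastforce
  obtain t where t: "t > 0" "\<And>x. x \<in> cube (index f) \<Longrightarrow>
    \<exists>w \<in> A f x. (\<Sum>i\<in>index f. w i * (if x i then t else 1)) \<le> \<kappa> * (if eval f x then t else 1)"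
    using ex_subinvariant_vector[OF f less] by blast
  define m where "m = min t 1"
  have m: "m > 0" using t by (simp add: m_def)
  have m': "m \<le> (if b then t else 1)" for b by (simp add: m_def)
  have "measure_of_family A (bfun_pow f (Suc n)) \<le> max t 1 / m * \<kappa> ^ Suc n" for n
  proof (rule measure_le[OF is_bfun_pow[OF f(1)] nonconstant_pow[OF f]])
    fix z assume z: "z \<in> cube (index (bfun_pow f (Suc n)))"
    obtain W where W: "W \<in> A (bfun_pow f (Suc n)) z"
      "total (index (bfun_pow f (Suc n))) W * m
        \<le> \<kappa> ^ Suc n * (if eval (bfun_pow f (Suc n)) z then t else 1)"
      using pow_weight_upper[OF f(1) I \<kappa>0 m' less_imp_le[OF m] t(2) z] by blast
    note W(2)
    also have "\<dots> \<le> \<kappa> ^ Suc n * max t 1" using \<kappa>0 by (intro mult_left_mono) auto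
    finally have "total (index (bfun_pow f (Suc n))) W \<le> max t 1 * \<kappa> ^ Suc n / m"
      using m by (simp only: pos_le_divide_eq mult.commute[of "max t 1"])
    then show "local_measure A (bfun_pow f (Suc n)) z \<le> max t 1 / m * \<kappa> ^ Suc n"
      by (intro local_measure_le[OF is_bfun_pow[OF f(1)] z W(1)]) (simp only: times_divide_eq_left)
  qed
  moreover have "max t 1 / m > 0" using m by auto
  ultimately show thesis using that by blast
qed

text \<open>A selector attaining the maximum has a superinvariant vector; the constant compares a
  positive coordinate \<open>v s\<close> with a bound \<open>M\<close> on both coordinates.\<close>

lemma measure_pow_lower:
  assumes f: "is_bfun f" "nonconstant f" and \<kappa>: "\<kappa> > 0" "\<kappa> < characteristic_value A f"
  obtains C where "C > 0" "\<And>n. C * \<kappa> ^ Suc n \<le> measure_of_family A (bfun_pow f (Suc n))"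
proof -
  note I = nonconstant_index_nonempty[OF f(2)]
  have "characteristic_value A f \<in> selector_value A f ` {\<alpha>. compatible_selector f \<alpha>}"
    unfolding characteristic_value_def
    using finite_compatible_selectors[OF f(1)] ex_compatible_selector[OF f(2)] by (intro Max_in) auto
  then obtain \<alpha> where \<alpha>: "compatible_selector f \<alpha>" "\<kappa> < selector_value A f \<alpha>" using \<kappa> by auto
  obtain v s where v: "\<And>b. v b \<ge> 0" "v s > 0"
    "\<And>b w. w \<in> A f (\<alpha> b) \<Longrightarrow> \<kappa> * v b \<le> (\<Sum>i\<in>index f. w i * v (\<alpha> b i))"
    using ex_superinvariant_vector[OF f(1) \<alpha>(1) \<kappa>(1) \<alpha>(2)] by metis
  define M where "M = v False + v True"
  have M: "v b \<le> M" for b using v(1)[of False] v(1)[of True] by (cases b) (auto simp: M_def)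
  have M0: "M > 0" using M[of s] v(2) by simp
  have "v s / M * \<kappa> ^ Suc n \<le> measure_of_family A (bfun_pow f (Suc n))" for n
  proof -
    obtain z where z: "z \<in> cube (index (bfun_pow f (Suc n)))"
      "\<And>W. W \<in> A (bfun_pow f (Suc n)) z \<Longrightarrow> \<kappa> ^ Suc n * v s \<le> total (index (bfun_pow f (Suc n))) W * M"
      using pow_weight_lower[OF f(1) I _ M _ \<alpha>(1) v(3), of n s] \<kappa> M0 by auto
    have "v s / M * \<kappa> ^ Suc n \<le> local_measure A (bfun_pow f (Suc n)) z"
    proof (rule local_measure_ge[OF is_bfun_pow[OF f(1)] z(1)])
      fix W assume "W \<in> A (bfun_pow f (Suc n)) z"
      from z(2)[OF this] have "v s * \<kappa> ^ Suc n / M \<le> total (index (bfun_pow f (Suc n))) W"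
        using M0 by (simp only: pos_divide_le_eq mult.commute[of "v s"])
      then show "v s / M * \<kappa> ^ Suc n \<le> total (index (bfun_pow f (Suc n))) W"
        by (simp only: times_divide_eq_left)
    qed
    then show ?thesis by (rule measure_ge[OF is_bfun_pow[OF f(1)] z(1)])
  qed
  then show thesis using that[of "v s / M"] v(2) M0 by simp
qed

end

section \<open>Passage to the limit\<close>

text \<open>The factor \<open>root k C\<close> tends to 1. The root of the product splits for
  positive \<open>k\<close>, which suffices for the limit.\<close>

lemma Liminf_root_geometric:
  assumes "C > 0" "\<kappa> \<ge> 0"
  shows "liminf (\<lambda>k. ereal (root k (C * \<kappa> ^ k))) = ereal \<kappa>"
proof -
  have "(\<lambda>k. root k C * \<kappa>) \<longlonglongrightarrow> 1 * \<kappa>"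
    by (intro tendsto_mult LIMSEQ_root_const tendsto_const assms)
  moreover have "\<forall>\<^sub>F k in sequentially. root k C * \<kappa> = root k (C * \<kappa> ^ k)"
    using eventually_gt_at_top[of 0]
    by eventually_elim (simp add: real_root_mult real_root_power_cancel assms)
  ultimately have "(\<lambda>k. root k (C * \<kappa> ^ k)) \<longlonglongrightarrow> \<kappa>"
    by (simp add: tendsto_cong)
  then show ?thesis by (intro lim_imp_Liminf) auto
qed

text \<open>Discards the exponent 0, where \<open>bfun_pow\<close> has a dummy value.\<close>

lemma eventually_sequentially_SucI:
  assumes "\<And>n. P (Suc n)"
  shows "\<forall>\<^sub>F k in sequentially. P k"
  using eventually_gt_at_top[of 0] by eventually_elim (metis assms gr0_implies_Suc)

theorem mainTheorem1:
  fixes A :: "'a label family" and f :: "'a label bfun"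
  assumes "assemblage A"
    and "well_behaved A"
    and "is_bfun f"
    and "nonconstant f"
  shows "measure_lim A f = ereal (characteristic_value A f)"
proof (rule antisym)
  interpret well_behaved_assemblage A by standard (rule assms)+
  note f = assms(3,4)
  show "measure_lim A f \<le> ereal (characteristic_value A f)"
  proof (rule ccontr)
    assume "\<not> ?thesis"
    \<comment> \<open>A real strictly between the two sides bounds the growth rate of the measure
      from above, hence also \<open>measure_lim\<close>.\<close>
    then obtain \<kappa> where \<kappa>: "characteristic_value A f < \<kappa>" "ereal \<kappa> < measure_lim A f"
      using ereal_dense2[of "ereal (characteristic_value A f)" "measure_lim A f"] by (auto simp: not_le)
    obtain C where C: "C > 0" "\<And>n. measure_of_family A (bfun_pow f (Suc n)) \<le> C * \<kappa> ^ Suc n"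
      using measure_pow_upper[OF f \<kappa>(1)] by blast
    \<comment> \<open>The measure of \<open>f\<close> itself is nonnegative, which forces the sign
      of \<open>\<kappa>\<close>.\<close>
    have "0 \<le> C * \<kappa> ^ Suc 0"
      using measure_nonneg[OF is_bfun_pow[OF f(1), of 0]] C(2)[of 0] by linarith
    then have "\<kappa> \<ge> 0" using C(1) by (simp add: zero_le_mult_iff)
    have "measure_lim A f \<le> liminf (\<lambda>k. ereal (root k (C * \<kappa> ^ k)))"
      unfolding measure_lim_def
      by (intro Liminf_mono eventually_sequentially_SucI) (simp only: ereal_less_eq(3) real_root_le_mono zero_less_Suc C(2))
    then show False using \<kappa>(2) Liminf_root_geometric[OF C(1) \<open>\<kappa> \<ge> 0\<close>] by simp
  qed
  show "ereal (characteristic_value A f) \<le> measure_lim A f"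
  proof (rule ccontr)
    assume "\<not> ?thesis"
    then obtain \<kappa> where \<kappa>: "\<kappa> < characteristic_value A f" "measure_lim A f < ereal \<kappa>"
      using ereal_dense2[of "measure_lim A f" "ereal (characteristic_value A f)"] by (auto simp: not_le)
    \<comment> \<open>This makes \<open>\<kappa>\<close> positive, as the geometric lower bound
      requires.\<close>
    have "0 \<le> measure_lim A f"
      unfolding measure_lim_def using measure_nonneg[OF is_bfun_pow[OF f(1)]]
      by (intro Liminf_bounded eventually_sequentially_SucI) simp
    then have "\<kappa> > 0" using \<kappa>(2) by (metis ereal_less(2) le_less_trans)
    obtain C where C: "C > 0" "\<And>n. C * \<kappa> ^ Suc n \<le> measure_of_family A (bfun_pow f (Suc n))"
      using measure_pow_lower[OF f \<open>\<kappa> > 0\<close> \<kappa>(1)] by blast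
    have "liminf (\<lambda>k. ereal (root k (C * \<kappa> ^ k))) \<le> measure_lim A f"
      unfolding measure_lim_def
      by (intro Liminf_mono eventually_sequentially_SucI) (simp only: ereal_less_eq(3) real_root_le_mono zero_less_Suc C(2))
    then show False using \<kappa>(2) \<open>\<kappa> > 0\<close> Liminf_root_geometric[OF C(1), of \<kappa>] by simp
  qed
qed

end
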